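(* Fix $\ell\in\{1,\dots,n\}$, let $q\in\Sigma\cap U_\ell$, and assume $\operatorname{rank}DG_\ell(q)=n+1$. Then $\Sigma$ is a smooth real analytic manifold of dimension $n-1$ near $q$, and $T_q\Sigma=\ker DG_\ell(q)$. Moreover, with $h=\operatorname{Log}|_\Sigma$, $$\operatorname{rank}dh_q=\operatorname{rank}\begin{pmatrix}DG_\ell(q)\\ D\operatorname{Log}(q)\end{pmatrix}-(n+1).$$ Consequently, $\operatorname{rank}dh_q<n-1$ if and only if $$\operatorname{rank}\begin{pmatrix}DG_\ell(q)\\ D\operatorname{Log}(q)\end{pmatrix}<2n.$$ Since this augmented matrix has $2n+1$ rows and $2n$ columns, the latter condition is equivalent to the vanishing of all its $2n\times2n$ minors.
   Context: $n$ is a positive integer, and $f\in\mathbb C[z_1^{\pm1},\dots,z_n^{\pm1}]$ is a Laurent polynomial such that $V=\{z\in(\mathbb C^* )^n\mid f(z)=0\}$ is smooth (the partial derivatives of $f$ do not vanish simultaneously at any point of $V$). $\operatorname{Log}(z)=(\log|z_1|,\dots,\log|z_n|)$ on $(\mathbb C^* )^n$, and $\Sigma\subset V$ is the set of points at which the real differential of $\operatorname{Log}|_V:V\to\mathbb R^n$ is not surjective. Put $F_j=z_j\,\partial f/\partial z_j$, and write $z_j=x_j+iy_j$, with real coordinates $X=(x_1,y_1,\dots,x_n,y_n)\in\mathbb R^{2n}$ on $(\mathbb C^* )^n$. Let $U_\ell=\{F_\ell\ne0\}$ (an open subset of $(\mathbb C^* )^n$), let $u=\operatorname{Re}f$, $v=\operatorname{Im}f$,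 choose an ordering $j_1,\dots,j_{n-1}$ of $\{1,\dots,n\}\setminus\{\ell\}$, and put $\rho_r^{(\ell)}=\operatorname{Im}(F_{j_r}\overline{F_\ell})$ for $1\le r\le n-1$. Define $G_\ell=(u,v,\rho_1^{(\ell)},\dots,\rho_{n-1}^{(\ell)}):U_\ell\to\mathbb R^{n+1}$; one has $\Sigma\cap U_\ell=G_\ell^{-1}(0)$. $DG_\ell$ is the $(n+1)\times2n$ real Jacobian matrix in the coordinates $X$, and $D\operatorname{Log}$ is the $n\times2n$ real Jacobian matrix of $\operatorname{Log}$ on $(\mathbb C^* )^n$, whose $j$-th row has entries $x_j/(x_j^2+y_j^2)$ and $y_j/(x_j^2+y_j^2)$ in the columns of $x_j$ and $y_j$ and zeros elsewhere. *)

theory Defs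
  imports "HOL-Analysis.Analysis" "HOL-Library.Poly_Mapping"
begin

section \<open>Laurent polynomials on the complex torus\<close>

text \<open>A Laurent polynomial in the variables indexed by \<open>'n\<close> (so \<open>n = CARD('n)\<close>) is a finitely
  supported family of complex coefficients indexed by exponent vectors.\<close>

type_synonym 'n laurent = "(int ^ 'n) \<Rightarrow>\<^sub>0 complex"

definition torus :: "(complex ^ 'n) set" where
  "torus = {z. \<forall>k. z $ k \<noteq> 0}"

definition laurent_eval :: "'n::finite laurent \<Rightarrow> complex ^ 'n \<Rightarrow> complex" where
  "laurent_eval f z =
     (\<Sum>\<alpha>\<in>Poly_Mapping.keys f. Poly_Mapping.lookup f \<alpha> * (\<Prod>k\<in>UNIV. (z $ k) powi (\<alpha> $ k)))"

definition laurent_partial :: "'n::finite laurent \<Rightarrow> 'n \<Rightarrow> complex ^ 'n \<Rightarrow> complex" where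
  "laurent_partial f k z = deriv (\<lambda>w. laurent_eval f (\<chi> i. if i = k then w else z $ i)) (z $ k)"

definition hypersurface :: "'n::finite laurent \<Rightarrow> (complex ^ 'n) set" where
  "hypersurface f = {z \<in> torus. laurent_eval f z = 0}"

definition smooth_hypersurface :: "'n::finite laurent \<Rightarrow> bool" where
  "smooth_hypersurface f \<longleftrightarrow> (\<forall>z\<in>hypersurface f. \<exists>k. laurent_partial f k z \<noteq> 0)"

definition log_partial :: "'n::finite laurent \<Rightarrow> 'n \<Rightarrow> complex ^ 'n \<Rightarrow> complex" where
  "log_partial f k z = z $ k * laurent_partial f k z"

definition Log :: "complex ^ 'n \<Rightarrow> real ^ 'n" where
  "Log z = (\<chi> k. ln (cmod (z $ k)))"


section \<open>Submanifolds of Euclidean space\<close>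

text \<open>Real analyticity on a set (used for open sets): local expansion into a convergent power
  series in several variables. Multi-indices are functions \<open>'k \<Rightarrow> nat\<close>; \<open>has_sum\<close> is unconditional
  (equivalently, absolute) convergence.\<close>

definition real_analytic_on :: "(real ^ 'k::finite \<Rightarrow> real ^ 'm::finite) \<Rightarrow> (real ^ 'k) set \<Rightarrow> bool"
  where
  "real_analytic_on g U \<longleftrightarrow>
     (\<forall>p\<in>U. \<exists>r>0. \<exists>c :: ('k \<Rightarrow> nat) \<Rightarrow> real ^ 'm. \<forall>x\<in>ball p r.
        ((\<lambda>\<alpha>. (\<Prod>k\<in>UNIV. (x $ k - p $ k) ^ \<alpha> k) *\<^sub>R c \<alpha>) has_sum g x) UNIV)"

text \<open>\<open>M\<close> is, near \<open>p\<close>, an embedded real analytic submanifold of dimension \<open>d\<close>: some bianalytic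
  chart of the ambient space around \<open>p\<close> flattens \<open>M\<close> to a \<open>d\<close>-dimensional linear subspace.
  The case \<open>d = 0\<close> (an isolated point) is included.\<close>

definition analytic_submanifold_near ::
  "(real ^ 'k::finite) set \<Rightarrow> nat \<Rightarrow> real ^ 'k \<Rightarrow> bool" where
  "analytic_submanifold_near M d p \<longleftrightarrow> p \<in> M \<and>
     (\<exists>U W \<psi> \<phi>. \<exists>L :: (real ^ 'k) set.
        open U \<and> p \<in> U \<and> open W \<and> homeomorphism U W \<psi> \<phi> \<and>
        real_analytic_on \<psi> U \<and> real_analytic_on \<phi> W \<and>
        subspace L \<and> dim L = d \<and> \<psi> ` (M \<inter> U) = W \<inter> L)"

text \<open>Velocities at \<open>p\<close> of \<open>C\<^sup>1\<close> curves in \<open>M\<close> through \<open>p\<close>. This is the usual tangent space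
  when \<open>M\<close> is an embedded submanifold near \<open>p\<close>; it is meaningful only at such points.\<close>

definition tangent_space :: "'a::real_normed_vector set \<Rightarrow> 'a \<Rightarrow> 'a set" where
  "tangent_space M p =
     {vector_derivative \<gamma> (at 0) | \<gamma>. \<exists>e>0. \<gamma> C1_differentiable_on {-e<..<e} \<and>
        \<gamma> ` {-e<..<e} \<subseteq> M \<and> \<gamma> 0 = p}"

text \<open>Image of the differential at \<open>p\<close> of the restriction of \<open>g\<close> to \<open>M\<close>: this differential is
  the differential of \<open>g\<close> restricted to the tangent space of \<open>M\<close>.\<close>

definition restr_diff_image ::
  "('a::real_normed_vector \<Rightarrow> 'b::real_normed_vector) \<Rightarrow> 'a set \<Rightarrow> 'a \<Rightarrow> 'b set" where
  "restr_diff_image g M p = frechet_derivative g (at p) ` tangent_space M p"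

definition restr_diff_rank ::
  "('a::real_normed_vector \<Rightarrow> 'b::euclidean_space) \<Rightarrow> 'a set \<Rightarrow> 'a \<Rightarrow> nat" where
  "restr_diff_rank g M p = dim (restr_diff_image g M p)"

definition critical_locus :: "'n::finite laurent \<Rightarrow> (complex ^ 'n) set" where
  "critical_locus f = {z \<in> hypersurface f. restr_diff_image Log (hypersurface f) z \<noteq> UNIV}"


section \<open>Real coordinates and Jacobian matrices\<close>

text \<open>The \<open>2n\<close> real coordinates are labelled by \<open>'n + 'n\<close>: \<open>Inl k\<close> is the label of \<open>x\<^sub>k\<close> and
  \<open>Inr k\<close> that of \<open>y\<^sub>k\<close>, where \<open>z\<^sub>k = x\<^sub>k + i y\<^sub>k\<close>.\<close>

definition to_real :: "complex ^ 'n \<Rightarrow> real ^ ('n + 'n)" where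
  "to_real z = (\<chi> c. case c of Inl k \<Rightarrow> Re (z $ k) | Inr k \<Rightarrow> Im (z $ k))"

definition of_real_coords :: "real ^ ('n + 'n) \<Rightarrow> complex ^ 'n" where
  "of_real_coords X = (\<chi> k. Complex (X $ Inl k) (X $ Inr k))"

definition real_jacobian ::
  "(complex ^ 'n::finite \<Rightarrow> real ^ 'm::finite) \<Rightarrow> complex ^ 'n \<Rightarrow> real ^ ('n + 'n) ^ 'm" where
  "real_jacobian g z = jacobian (g \<circ> of_real_coords) (at (to_real z))"

definition U_chart :: "'n::finite laurent \<Rightarrow> 'n \<Rightarrow> (complex ^ 'n) set" where
  "U_chart f l = {z \<in> torus. log_partial f l z \<noteq> 0}"

definition rho :: "'n::finite laurent \<Rightarrow> 'n \<Rightarrow> 'n \<Rightarrow> complex ^ 'n \<Rightarrow> real" where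
  "rho f l k z = Im (log_partial f k z * cnj (log_partial f l z))"

text \<open>The components of \<open>G\<close> are indexed by a type \<open>'r\<close> with \<open>n + 1\<close> elements: \<open>iu\<close> and \<open>iv\<close> are
  the positions of \<open>Re f\<close> and \<open>Im f\<close>, and \<open>j\<close> enumerates, by the remaining \<open>n - 1\<close> positions,
  the variables other than \<open>l\<close>. (No positions remain if \<open>n = 1\<close>.)\<close>

definition row_ordering :: "'n::finite \<Rightarrow> 'r::finite \<Rightarrow> 'r \<Rightarrow> ('r \<Rightarrow> 'n) \<Rightarrow> bool" where
  "row_ordering l iu iv j \<longleftrightarrow> iu \<noteq> iv \<and> bij_betw j (UNIV - {iu, iv}) (UNIV - {l})"

definition G_map ::
  "'n::finite laurent \<Rightarrow> 'n \<Rightarrow> 'r \<Rightarrow> 'r \<Rightarrow> ('r::finite \<Rightarrow> 'n) \<Rightarrow> complex ^ 'n \<Rightarrow> real ^ 'r" where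
  "G_map f l iu iv j z =
     (\<chi> i. if i = iu then Re (laurent_eval f z)
          else if i = iv then Im (laurent_eval f z)
          else rho f l (j i) z)"

definition stack :: "'a ^ 'c ^ 'r \<Rightarrow> 'a ^ 'c ^ 's \<Rightarrow> 'a ^ 'c ^ ('r + 's)" where
  "stack A B = (\<chi> i. case i of Inl r \<Rightarrow> A $ r | Inr s \<Rightarrow> B $ s)"

definition DG :: "'n::finite laurent \<Rightarrow> 'n \<Rightarrow> 'r \<Rightarrow> 'r \<Rightarrow> ('r::finite \<Rightarrow> 'n) \<Rightarrow> complex ^ 'n \<Rightarrow>
    real ^ ('n + 'n) ^ 'r" where
  "DG f l iu iv j z = real_jacobian (G_map f l iu iv j) z"

definition DLog :: "complex ^ 'n::finite \<Rightarrow> real ^ ('n + 'n) ^ 'n" where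
  "DLog z = real_jacobian Log z"

definition augmented :: "'n::finite laurent \<Rightarrow> 'n \<Rightarrow> 'r \<Rightarrow> 'r \<Rightarrow> ('r::finite \<Rightarrow> 'n) \<Rightarrow> complex ^ 'n \<Rightarrow>
    real ^ ('n + 'n) ^ ('r + 'n)" where
  "augmented f l iu iv j z = stack (DG f l iu iv j z) (DLog z)"

text \<open>The maximal minor of \<open>A\<close> using all columns and the rows \<open>s c\<close>. For injective \<open>s\<close>, listing
  the same rows in another order only changes the sign.\<close>

definition row_minor :: "'a::comm_ring_1 ^ 'c::finite ^ 'r \<Rightarrow> ('c \<Rightarrow> 'r) \<Rightarrow> 'a" where
  "row_minor A s = det (\<chi> c. A $ s c)"


section \<open>Consistency checks\<close>

lemma row_ordering_card:
  fixes l :: "'n::finite" and iu iv :: "'r::finite"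
  assumes "row_ordering l iu iv j"
  shows "CARD('r) = CARD('n) + 1"
proof -
  have "card (UNIV - {iu, iv}) = card (UNIV - {l})"
    using assms bij_betw_same_card unfolding row_ordering_def by blast
  moreover have "card (UNIV - {iu, iv}) = CARD('r) - 2"
    using assms by (subst card_Diff_subset) (auto simp: row_ordering_def)
  moreover have "card (UNIV - {l}) = CARD('n) - 1"
    by (subst card_Diff_subset) auto
  moreover have "card {iu, iv} \<le> CARD('r)"
    by (rule card_mono) auto
  moreover have "card {iu, iv} = 2"
    using assms by (auto simp: row_ordering_def)
  moreover have "CARD('n) > 0" by simp
  ultimately show ?thesis by linarith
qed

lemma of_real_coords_to_real [simp]: "of_real_coords (to_real z) = z"
  by (simp add: of_real_coords_def to_real_def vec_eq_iff)

lemma to_real_of_real_coords [simp]: "to_real (of_real_coords X) = X"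
  by (simp add: of_real_coords_def to_real_def vec_eq_iff split: sum.split)

lemma DLog_entries:
  fixes z :: "complex ^ 'n::finite"
  assumes "z \<in> torus"
  shows "DLog z $ k $ Inl i =
           (if i = k then Re (z $ k) / ((Re (z $ k))\<^sup>2 + (Im (z $ k))\<^sup>2) else 0)"
    and "DLog z $ k $ Inr i =
           (if i = k then Im (z $ k) / ((Re (z $ k))\<^sup>2 + (Im (z $ k))\<^sup>2) else 0)"
proof -
  define X where "X = to_real z"
  define N where "N k = (X $ Inl k)\<^sup>2 + (X $ Inr k)\<^sup>2" for k :: 'n
  define L where "L = (\<lambda>H::real^('n+'n). \<chi> k.
     (X $ Inl k * H $ Inl k + X $ Inr k * H $ Inr k) / N k)"
  have N: "N k > 0" for k
    using assms unfolding N_def X_def torus_def to_real_def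
    by (auto simp: complex_eq_iff sum_power2_gt_zero_iff)
  have eq: "(Log \<circ> of_real_coords) = (\<lambda>Y::real^('n+'n). \<chi> k. ln (sqrt ((Y $ Inl k)\<^sup>2 + (Y $ Inr k)\<^sup>2)))"
    by (auto simp: Log_def of_real_coords_def fun_eq_iff vec_eq_iff cmod_def)
  have d: "((\<lambda>Y::real^('n+'n). Y $ c) has_derivative (\<lambda>H. H $ c)) (at X)" for c
    by (intro bounded_linear_imp_has_derivative bounded_linear_vec_nth)
  have "((\<lambda>Y::real^('n+'n). ln (sqrt ((Y $ Inl k)\<^sup>2 + (Y $ Inr k)\<^sup>2))) has_derivative
      (\<lambda>H. (X $ Inl k * H $ Inl k + X $ Inr k * H $ Inr k) / N k)) (at X)" for k
  proof -
    have *: "(\<lambda>Y::real^('n+'n). ln (sqrt ((Y $ Inl k)\<^sup>2 + (Y $ Inr k)\<^sup>2))) =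
        (\<lambda>Y. ln ((Y $ Inl k)\<^sup>2 + (Y $ Inr k)\<^sup>2) / 2)"
      by (simp add: ln_sqrt fun_eq_iff)
    show ?thesis
      unfolding * using N[of k] unfolding N_def
      by (auto intro!: derivative_eq_intros d simp: fun_eq_iff divide_simps) (auto simp: algebra_simps)
  qed
  hence "((Log \<circ> of_real_coords) has_derivative L) (at X)"
    unfolding eq L_def has_derivative_componentwise_within[where f = "\<lambda>Y. \<chi> k. _ Y k"]
    by (auto simp: Basis_vec_def inner_axis)
  hence "frechet_derivative (Log \<circ> of_real_coords) (at X) = L"
    by (rule frechet_derivative_at[symmetric])
  hence J: "DLog z $ k $ c = L (axis c 1) $ k" for c
    by (simp add: DLog_def real_jacobian_def jacobian_def matrix_def X_def)
  show "DLog z $ k $ Inl i =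
           (if i = k then Re (z $ k) / ((Re (z $ k))\<^sup>2 + (Im (z $ k))\<^sup>2) else 0)"
    and "DLog z $ k $ Inr i =
           (if i = k then Im (z $ k) / ((Re (z $ k))\<^sup>2 + (Im (z $ k))\<^sup>2) else 0)"
    unfolding J by (auto simp: L_def N_def X_def to_real_def axis_def)
qed

end

theory Submission
  imports Defs
begin

text \<open>
  Near \<open>q\<close> the critical locus is the zero set of \<open>G = (u, v, \<rho>\<^sub>1, \<dots>)\<close>. Indeed, in the
  logarithmic coordinates \<open>w\<^sub>k = dz\<^sub>k / z\<^sub>k\<close> a tangent vector of \<open>V\<close> is a solution of
  \<open>\<Sum>\<^sub>k F\<^sub>k w\<^sub>k = 0\<close>, and \<open>d Log\<close> takes it to the vector of the real parts of the \<open>w\<^sub>k\<close>. If all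
  \<open>F\<^sub>k\<close> are real multiples of \<open>F\<^sub>l\<close>, the real parts satisfy a nontrivial real linear equation;
  if some \<open>F\<^sub>m\<close> is not, then \<open>F\<^sub>m\<close> and \<open>F\<^sub>l\<close> span \<open>\<complex>\<close> over \<open>\<real>\<close>, and suitable imaginary parts of
  \<open>w\<^sub>m\<close> and \<open>w\<^sub>l\<close> complete any prescribed real parts to a solution (lemma \<open>critical_locus_iff\<close>).

  The statements on the submanifold and its tangent space are then the regular value theorem in
  the real analytic category (theorem \<open>analytic_level_set\<close>). If \<open>A\<close> is a linear right inverse of
  \<open>D = DG(q)\<close>, the map \<open>\<psi>(X) = (X - q) + A (G X - D (X - q))\<close> has the identity as its
  derivative at \<open>q\<close>, and \<open>D (\<psi> X) = G X\<close>; so \<open>\<psi>\<close> takes the level set to the linear subspace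
  \<open>ker D\<close>. It remains to see that \<open>\<psi>\<close> has a real analytic inverse.

  This inverse is found by iteration (lemma \<open>near_identity_inverse\<close>). Power series that converge
  absolutely on a cube of half-width \<open>r\<close> form a Banach algebra under the weighted \<open>\<ell>\<^sup>1\<close> norm
  \<open>\<Sum>\<^sub>\<alpha> \<bar>c\<^sub>\<alpha>\<bar> r\<^bsup>\<bar>\<alpha>\<bar>\<^esup>\<close> of their coefficients. Let \<open>N = \<psi> - id\<close> in coordinates centred at \<open>q\<close>. As
  \<open>N\<close> vanishes to second order, \<open>\<phi> \<mapsto> N \<circ> \<phi>\<close> halves distances in this norm when the cube is
  small, and the iterates \<open>\<phi>\<^bsub>n+1\<^esub> = id - N \<circ> \<phi>\<^sub>n\<close> converge to a power series \<open>\<phi>\<close> with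
  \<open>\<phi> + N \<circ> \<phi> = id\<close>. The same argument gives the existence of the inverse and its analyticity.

  The rank formula is linear algebra: \<open>d Log\<close> is applied to \<open>T\<^sub>q\<Sigma> = ker DG(q)\<close>, and for any two
  matrices with equally many columns the rank of \<open>A\<close> on top of \<open>B\<close> is
  \<open>rank A + dim (B (ker A))\<close> (lemma \<open>rank_stack\<close>).
\<close>

section \<open>Families with bounded finite partial sums\<close>

text \<open>For nonnegative families this says that the family is summable with sum at most \<open>C\<close>. Bounding
  the finite partial sums keeps summability and the estimate in one predicate.\<close>

definition sums_below :: "('i \<Rightarrow> real) \<Rightarrow> 'i set \<Rightarrow> real \<Rightarrow> bool" where
  "sums_below a I C \<longleftrightarrow> (\<forall>F. finite F \<longrightarrow> F \<subseteq> I \<longrightarrow> sum a F \<le> C)"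

lemma sums_belowI: "(\<And>F. finite F \<Longrightarrow> F \<subseteq> I \<Longrightarrow> sum a F \<le> C) \<Longrightarrow> sums_below a I C"
  by (simp add: sums_below_def)

lemma sums_belowD: "sums_below a I C \<Longrightarrow> finite F \<Longrightarrow> F \<subseteq> I \<Longrightarrow> sum a F \<le> C"
  by (simp add: sums_below_def)

lemma sums_below_mono:
  assumes "sums_below b I C" "\<And>i. i \<in> I \<Longrightarrow> a i \<le> b i" "C \<le> D"
  shows "sums_below a I D"
proof (rule sums_belowI)
  fix F assume "finite F" "F \<subseteq> I"
  then have "sum a F \<le> sum b F" by (intro sum_mono) (use assms in auto)
  also have "\<dots> \<le> C" using assms \<open>finite F\<close> \<open>F \<subseteq> I\<close> by (auto simp: sums_below_def)
  finally show "sum a F \<le> D" using assms by simp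
qed

lemma sums_below_cmult: "sums_below a I C \<Longrightarrow> 0 \<le> k \<Longrightarrow> sums_below (\<lambda>i. k * a i) I (k * C)"
  unfolding sums_below_def by (simp add: sum_distrib_left[symmetric] mult_left_mono)

lemma sums_below_nonneg: "sums_below a I C \<Longrightarrow> 0 \<le> C"
  using sums_belowD[of a I C "{}"] by simp

lemma sums_below_summable:
  assumes "sums_below a I C" "\<And>i. i \<in> I \<Longrightarrow> 0 \<le> a i"
  shows "a summable_on I"
proof (rule nonneg_bdd_above_summable_on)
  show "bdd_above (sum a ` {F. F \<subseteq> I \<and> finite F})"
    using assms(1) by (intro bdd_aboveI[of _ C]) (auto simp: sums_below_def)
qed (use assms in auto)

lemma sums_below_infsum:
  assumes "sums_below a I C" "\<And>i. i \<in> I \<Longrightarrow> 0 \<le> a i"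
  shows "infsum a I \<le> C"
  using sums_below_summable[OF assms] assms(1)
  by (intro infsum_le_finite_sums) (auto simp: sums_below_def)

lemma sums_below_Times:
  assumes b: "sums_below b I D" and a: "\<And>i. i \<in> I \<Longrightarrow> sums_below (\<lambda>j. a (i, j)) J (b i)"
    and nn: "\<And>i j. 0 \<le> a (i, j)"
  shows "sums_below a (I \<times> J) D"
proof (rule sums_belowI)
  fix F assume F: "finite F" "F \<subseteq> I \<times> J"
  have "sum a F \<le> sum a (fst ` F \<times> snd ` F)"
  proof (rule sum_mono2)
    show "finite (fst ` F \<times> snd ` F)" using F by simp
    show "F \<subseteq> fst ` F \<times> snd ` F" by (rule subset_fst_snd)
    show "0 \<le> a p" for p using nn[of "fst p" "snd p"] by simp
  qed
  also have "\<dots> = (\<Sum>i\<in>fst ` F. \<Sum>j\<in>snd ` F. a (i, j))"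
    by (simp add: sum.cartesian_product)
  also have "\<dots> \<le> (\<Sum>i\<in>fst ` F. b i)"
    by (intro sum_mono sums_belowD[OF a]) (use F in auto)
  also have "\<dots> \<le> D" by (rule sums_belowD[OF b]) (use F in auto)
  finally show "sum a F \<le> D" .
qed

section \<open>Power series on a cube, with a weighted norm bound\<close>

definition mpow :: "real ^ 'k::finite \<Rightarrow> ('k \<Rightarrow> nat) \<Rightarrow> real" where
  "mpow x \<alpha> = (\<Prod>k\<in>UNIV. (x $ k) ^ \<alpha> k)"

definition mdeg :: "('k::finite \<Rightarrow> nat) \<Rightarrow> nat" where
  "mdeg \<alpha> = (\<Sum>k\<in>UNIV. \<alpha> k)"

definition closed_cube :: "real \<Rightarrow> (real ^ 'k::finite) set" where
  "closed_cube r = {x. \<forall>k. \<bar>x $ k\<bar> \<le> r}"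

lemma mpow_add: "mpow x (\<lambda>k. \<alpha> k + \<beta> k) = mpow x \<alpha> * mpow x \<beta>"
  by (simp add: mpow_def power_add prod.distrib)

lemma mdeg_add: "mdeg (\<lambda>k. \<alpha> k + \<beta> k) = mdeg \<alpha> + mdeg \<beta>"
  by (simp add: mdeg_def sum.distrib)

lemma mpow_0 [simp]: "mpow x (\<lambda>_. 0) = 1" by (simp add: mpow_def)
lemma mdeg_0 [simp]: "mdeg (\<lambda>_. 0) = 0" by (simp add: mdeg_def)

lemma prod_const_power: "(\<Prod>k\<in>(UNIV::'k::finite set). r ^ \<alpha> k) = (r::real) ^ mdeg \<alpha>"
  by (simp add: mdeg_def power_sum)

lemma abs_mpow_le:
  assumes "x \<in> closed_cube r" shows "\<bar>mpow x \<alpha>\<bar> \<le> r ^ mdeg \<alpha>"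
proof -
  have "\<bar>mpow x \<alpha>\<bar> = (\<Prod>k\<in>UNIV. \<bar>x $ k\<bar> ^ \<alpha> k)"
    by (simp add: mpow_def abs_prod power_abs)
  also have "\<dots> \<le> (\<Prod>k\<in>(UNIV::'a set). r ^ \<alpha> k)"
    by (rule prod_mono) (use assms in \<open>auto simp: closed_cube_def intro!: power_mono\<close>)
  finally show ?thesis by (simp add: prod_const_power)
qed

text \<open>The coefficients \<open>c\<close> represent \<open>g\<close> on the closed cube, and their weighted \<open>\<ell>\<^sup>1\<close> norm is
  at most \<open>C\<close>. The weights \<open>r\<^bsup>\<bar>\<alpha>\<bar>\<^esup>\<close> are multiplicative in \<open>\<alpha>\<close>, hence
  the norm is submultiplicative; and they dominate the monomials on the cube, hence all
  rearrangements below are covered by absolute convergence.\<close>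

definition expands ::
  "real \<Rightarrow> real \<Rightarrow> (('k::finite \<Rightarrow> nat) \<Rightarrow> 'a::banach) \<Rightarrow> (real ^ 'k \<Rightarrow> 'a) \<Rightarrow> bool" where
  "expands r C c g \<longleftrightarrow> 0 < r \<and> sums_below (\<lambda>\<alpha>. norm (c \<alpha>) * r ^ mdeg \<alpha>) UNIV C \<and>
     (\<forall>x\<in>closed_cube r. ((\<lambda>\<alpha>. mpow x \<alpha> *\<^sub>R c \<alpha>) has_sum g x) UNIV)"

definition pseries :: "real \<Rightarrow> real \<Rightarrow> (real ^ 'k::finite \<Rightarrow> 'a::banach) \<Rightarrow> bool" where
  "pseries r C g \<longleftrightarrow> (\<exists>c. expands r C c g)"

lemma pseries_pos: "pseries r C g \<Longrightarrow> 0 < r"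
  by (auto simp: pseries_def expands_def)

lemma pseries_nonneg: "pseries r C g \<Longrightarrow> 0 \<le> C"
  by (auto simp: pseries_def expands_def dest: sums_below_nonneg)

lemma weighted_abs_summable:
  fixes a :: "'i \<Rightarrow> 'a::banach"
  assumes "0 < r" "sums_below (\<lambda>i. norm (a i) * r ^ mdeg (e i)) I C" "x \<in> closed_cube r"
  shows "(\<lambda>i. norm (mpow x (e i) *\<^sub>R a i)) summable_on I"
proof (rule Infinite_Sum.abs_summable_on_comparison_test')
  show "(\<lambda>i. norm (a i) * r ^ mdeg (e i)) summable_on I"
    by (rule sums_below_summable[OF assms(2)]) (use assms in auto)
  show "norm (mpow x (e i) *\<^sub>R a i) \<le> norm (a i) * r ^ mdeg (e i)" for i
    using mult_right_mono[OF abs_mpow_le[OF assms(3), of "e i"], of "norm (a i)"]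
    by (simp add: mult.commute)
qed

text \<open>A sum of monomials in which exponents may repeat is a power series: terms with equal exponents
  are collected, and the triangle inequality shows that the weighted norm does not increase. Products
  and infinite sums of power series are obtained by choosing the index set and the exponent map.\<close>

lemma pseries_regroup:
  fixes a :: "'i \<Rightarrow> 'a::banach" and e :: "'i \<Rightarrow> 'k::finite \<Rightarrow> nat"
  assumes r: "0 < r" and bd: "sums_below (\<lambda>i. norm (a i) * r ^ mdeg (e i)) I C"
    and hs: "\<And>x. x \<in> closed_cube r \<Longrightarrow> ((\<lambda>i. mpow x (e i) *\<^sub>R a i) has_sum g x) I"
  shows "pseries r C g"
proof -
  define fib where "fib \<alpha> = {i \<in> I. e i = \<alpha>}" for \<alpha>
  define c where "c \<alpha> = infsum a (fib \<alpha>)" for \<alpha>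
  have nn: "0 \<le> norm (a i) * r ^ mdeg (e i)" for i using r by simp
  have sumI: "(\<lambda>i. norm (a i) * r ^ mdeg (e i)) summable_on I"
    by (rule sums_below_summable[OF bd nn])
  have sumfib: "(\<lambda>i. norm (a i) * r ^ mdeg (e i)) summable_on fib \<alpha>" for \<alpha>
    by (rule summable_on_subset_banach[OF sumI]) (auto simp: fib_def)
  have absfib: "(\<lambda>i. norm (a i)) summable_on fib \<alpha>" for \<alpha>
  proof -
    have "(\<lambda>i. norm (a i) * r ^ mdeg \<alpha>) summable_on fib \<alpha>"
      using sumfib[of \<alpha>] by (rule summable_on_cong[THEN iffD1, rotated]) (auto simp: fib_def)
    then show ?thesis using r by (subst (asm) summable_on_cmult_left') auto
  qed
  have cnorm: "norm (c \<alpha>) * r ^ mdeg \<alpha> \<le> (\<Sum>\<^sub>\<infinity>i\<in>fib \<alpha>. norm (a i) * r ^ mdeg (e i))" for \<alpha>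
  proof -
    have "norm (c \<alpha>) * r ^ mdeg \<alpha> \<le> (\<Sum>\<^sub>\<infinity>i\<in>fib \<alpha>. norm (a i)) * r ^ mdeg \<alpha>"
      unfolding c_def by (intro mult_right_mono norm_infsum_bound absfib) (use r in auto)
    also have "\<dots> = (\<Sum>\<^sub>\<infinity>i\<in>fib \<alpha>. norm (a i) * r ^ mdeg \<alpha>)"
      by (rule infsum_cmult_left'[symmetric])
    also have "\<dots> = (\<Sum>\<^sub>\<infinity>i\<in>fib \<alpha>. norm (a i) * r ^ mdeg (e i))"
      by (rule infsum_cong) (auto simp: fib_def)
    finally show ?thesis .
  qed
  have "sums_below (\<lambda>\<alpha>. norm (c \<alpha>) * r ^ mdeg \<alpha>) UNIV C"
  proof (rule sums_belowI)
    fix F :: "('k \<Rightarrow> nat) set" assume F: "finite F"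
    have "(\<Sum>\<alpha>\<in>F. norm (c \<alpha>) * r ^ mdeg \<alpha>) \<le> (\<Sum>\<alpha>\<in>F. \<Sum>\<^sub>\<infinity>i\<in>fib \<alpha>. norm (a i) * r ^ mdeg (e i))"
      by (intro sum_mono cnorm)
    also have "\<dots> = (\<Sum>\<^sub>\<infinity>i\<in>(\<Union>\<alpha>\<in>F. fib \<alpha>). norm (a i) * r ^ mdeg (e i))"
      by (rule sum_infsum[OF F sumfib]) (auto simp: fib_def)
    also have "\<dots> \<le> C"
      by (rule sums_below_infsum)
         (use bd nn in \<open>auto simp: sums_below_def fib_def subset_iff\<close>)
    finally show "(\<Sum>\<alpha>\<in>F. norm (c \<alpha>) * r ^ mdeg \<alpha>) \<le> C" .
  qed
  moreover have "((\<lambda>\<alpha>. mpow x \<alpha> *\<^sub>R c \<alpha>) has_sum g x) UNIV" if x: "x \<in> closed_cube r" for x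
  proof (rule has_sum_SigmaD)
    have bij: "bij_betw snd (Sigma UNIV fib) I"
      by (rule bij_betwI[where g = "\<lambda>i. (e i, i)"]) (auto simp: fib_def)
    show "((\<lambda>p. mpow x (e (snd p)) *\<^sub>R a (snd p)) has_sum g x) (Sigma UNIV fib)"
      using hs[OF x] has_sum_reindex_bij_betw[OF bij, of "\<lambda>i. mpow x (e i) *\<^sub>R a i"] by simp
    show "((\<lambda>i. mpow x (e (snd (\<alpha>, i))) *\<^sub>R a (snd (\<alpha>, i))) has_sum mpow x \<alpha> *\<^sub>R c \<alpha>) (fib \<alpha>)" for \<alpha>
    proof -
      have "(a has_sum c \<alpha>) (fib \<alpha>)"
        unfolding c_def by (rule has_sum_infsum[OF abs_summable_summable[OF absfib]])
      then have "((\<lambda>i. mpow x \<alpha> *\<^sub>R a i) has_sum mpow x \<alpha> *\<^sub>R c \<alpha>) (fib \<alpha>)"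
        by (rule has_sum_scaleR)
      then show ?thesis
        by (rule has_sum_cong[THEN iffD1, rotated]) (auto simp: fib_def)
    qed
  qed
  ultimately show ?thesis using r by (auto simp: pseries_def expands_def)
qed

lemma pseries_norm_le:
  assumes "pseries r C g" "x \<in> closed_cube r"
  shows "norm (g x) \<le> C"
proof -
  obtain c where c: "expands r C c g" using assms by (auto simp: pseries_def)
  have bd: "sums_below (\<lambda>\<alpha>. norm (c \<alpha>) * r ^ mdeg \<alpha>) UNIV C" and r: "0 < r"
    and hs: "((\<lambda>\<alpha>. mpow x \<alpha> *\<^sub>R c \<alpha>) has_sum g x) UNIV"
    using c assms by (auto simp: expands_def)
  have "norm (g x) \<le> (\<Sum>\<^sub>\<infinity>\<alpha>. norm (c \<alpha>) * r ^ mdeg \<alpha>)"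
  proof (rule norm_infsum_le[OF hs])
    show "((\<lambda>\<alpha>. norm (c \<alpha>) * r ^ mdeg \<alpha>) has_sum (\<Sum>\<^sub>\<infinity>\<alpha>. norm (c \<alpha>) * r ^ mdeg \<alpha>)) UNIV"
      by (intro has_sum_infsum sums_below_summable[OF bd]) (use r in auto)
    show "norm (mpow x \<alpha> *\<^sub>R c \<alpha>) \<le> norm (c \<alpha>) * r ^ mdeg \<alpha>" for \<alpha>
      using mult_right_mono[OF abs_mpow_le[OF assms(2), of \<alpha>], of "norm (c \<alpha>)"]
      by (simp add: mult.commute)
  qed
  also have "\<dots> \<le> C" by (rule sums_below_infsum[OF bd]) (use r in auto)
  finally show ?thesis .
qed

lemma closed_cube_mono: "r \<le> s \<Longrightarrow> x \<in> closed_cube r \<Longrightarrow> x \<in> closed_cube s"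
  unfolding closed_cube_def using order_trans by blast

lemma pseries_mono:
  assumes "pseries r C g" "0 < s" "s \<le> r" "C \<le> D"
  shows "pseries s D g"
proof -
  obtain c where c: "expands r C c g" using assms by (auto simp: pseries_def)
  have "sums_below (\<lambda>\<alpha>. norm (c \<alpha>) * s ^ mdeg \<alpha>) UNIV D"
    by (rule sums_below_mono[where b = "\<lambda>\<alpha>. norm (c \<alpha>) * r ^ mdeg \<alpha>" and C = C])
       (use c assms in \<open>auto simp: expands_def intro!: mult_left_mono power_mono\<close>)
  then have "expands s D c g"
    using c assms by (auto simp: expands_def intro: closed_cube_mono)
  then show ?thesis by (auto simp: pseries_def)
qed

lemma pseries_cong:
  assumes "pseries r C g" "\<And>x. x \<in> closed_cube r \<Longrightarrow> g x = h x"
  shows "pseries r C h"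
proof -
  obtain c where c: "expands r C c g" using assms(1) by (auto simp: pseries_def)
  then have "expands r C c h" by (simp add: expands_def assms(2)[symmetric])
  then show ?thesis by (auto simp: pseries_def)
qed

lemma pseries_monomial:
  assumes "0 < r"
  shows "pseries r (norm a * r ^ mdeg \<alpha>) (\<lambda>x. mpow x \<alpha> *\<^sub>R a)"
proof (rule pseries_regroup[where I = "{()}" and a = "\<lambda>_. a" and e = "\<lambda>_. \<alpha>"])
  show "sums_below (\<lambda>i. norm a * r ^ mdeg \<alpha>) {()} (norm a * r ^ mdeg \<alpha>)"
  proof (rule sums_belowI)
    fix F assume "F \<subseteq> {()}"
    then have "F = {} \<or> F = {()}" by blast
    then show "(\<Sum>i\<in>F. norm a * r ^ mdeg \<alpha>) \<le> norm a * r ^ mdeg \<alpha>" using assms by auto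
  qed
  show "((\<lambda>i. mpow x \<alpha> *\<^sub>R a) has_sum mpow x \<alpha> *\<^sub>R a) {()}" for x
    using has_sum_finite[of "{()}" "\<lambda>_. mpow x \<alpha> *\<^sub>R a"] by simp
qed (rule assms)

lemma pseries_const: "0 < r \<Longrightarrow> pseries r (norm a) (\<lambda>_. a)"
  using pseries_monomial[of r a "\<lambda>_. 0"] by simp

lemma mpow_single: "mpow x (\<lambda>i. if i = k then 1 else 0) = x $ k"
proof -
  have "mpow x (\<lambda>i. if i = k then 1 else 0) = (\<Prod>i\<in>UNIV. if i = k then x $ k else 1)"
    unfolding mpow_def by (rule prod.cong) auto
  then show ?thesis by simp
qed

lemma mdeg_single: "mdeg (\<lambda>i. if i = k then 1 else 0) = 1"
  by (simp add: mdeg_def)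

lemma pseries_coord:
  assumes "0 < r"
  shows "pseries r r (\<lambda>x :: real ^ 'k::finite. x $ k)"
  using pseries_monomial[OF assms, of "1::real" "\<lambda>i. if i = k then 1 else 0"]
  unfolding mpow_single mdeg_single by simp

text \<open>Completeness of the norm: a series of power series whose norm bounds are summable is again a
  power series. It is used both for the composition of power series and for limits of iterations.\<close>

lemma pseries_infsum:
  fixes h :: "'j \<Rightarrow> real ^ 'k::finite \<Rightarrow> 'a::banach"
  assumes r: "0 < r" and h: "\<And>j. j \<in> J \<Longrightarrow> pseries r (D j) (h j)" and D: "sums_below D J C"
    and g: "\<And>x. x \<in> closed_cube r \<Longrightarrow> ((\<lambda>j. h j x) has_sum g x) J"
  shows "pseries r C g"
proof -
  have "\<forall>j\<in>J. \<exists>c. expands r (D j) c (h j)" using h by (auto simp: pseries_def)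
  then obtain c where c: "\<And>j. j \<in> J \<Longrightarrow> expands r (D j) (c j) (h j)" by metis
  define a where "a p = c (fst p) (snd p)" for p
  have bd: "sums_below (\<lambda>p. norm (a p) * r ^ mdeg (snd p)) (J \<times> UNIV) C"
    by (rule sums_below_Times[OF D]) (use c r in \<open>auto simp: expands_def a_def\<close>)
  show ?thesis
  proof (rule pseries_regroup[OF r bd])
    fix x :: "real ^ 'k" assume x: "x \<in> closed_cube r"
    show "((\<lambda>p. mpow x (snd p) *\<^sub>R a p) has_sum g x) (J \<times> UNIV)"
    proof (rule has_sum_SigmaI[OF _ g[OF x]])
      show "(\<lambda>p. mpow x (snd p) *\<^sub>R a p) summable_on J \<times> UNIV"
        by (rule abs_summable_summable[OF weighted_abs_summable[OF r bd x]])
      show "((\<lambda>\<alpha>. mpow x (snd (j, \<alpha>)) *\<^sub>R a (j, \<alpha>)) has_sum h j x) UNIV" if "j \<in> J" for j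
        using c[OF that] x by (auto simp: expands_def a_def)
    qed
  qed
qed

lemma pseries_sum:
  assumes "0 < r" "finite J" "\<And>j. j \<in> J \<Longrightarrow> pseries r (D j) (h j)"
  shows "pseries r (sum D J) (\<lambda>x. \<Sum>j\<in>J. h j x)"
proof (rule pseries_infsum[where J = J and D = D and h = h])
  show "sums_below D J (sum D J)"
    using assms pseries_nonneg[OF assms(3)] by (auto intro!: sums_belowI sum_mono2)
qed (use assms in simp_all)

lemma pseries_add:
  assumes "pseries r C g" "pseries r D h"
  shows "pseries r (C + D) (\<lambda>x. g x + h x)"
proof -
  have "pseries r (\<Sum>b\<in>UNIV. if b then C else D) (\<lambda>x. \<Sum>b\<in>UNIV. (if b then g else h) x)"
    by (rule pseries_sum) (use assms pseries_pos[OF assms(1)] in auto)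
  then show ?thesis by (simp add: UNIV_bool add.commute)
qed

lemma pseries_bounded_linear:
  assumes g: "pseries r C g" and T: "bounded_linear T" and K: "0 \<le> K" "\<And>y. norm (T y) \<le> K * norm y"
  shows "pseries r (K * C) (\<lambda>x. T (g x))"
proof -
  interpret T: bounded_linear T by fact
  obtain c where c: "expands r C c g" using g by (auto simp: pseries_def)
  have "sums_below (\<lambda>\<alpha>. norm (T (c \<alpha>)) * r ^ mdeg \<alpha>) UNIV (K * C)"
  proof (rule sums_below_mono[OF sums_below_cmult[OF _ K(1)]])
    show "norm (T (c \<alpha>)) * r ^ mdeg \<alpha> \<le> K * (norm (c \<alpha>) * r ^ mdeg \<alpha>)" for \<alpha>
      using mult_right_mono[OF K(2)[of "c \<alpha>"], of "r ^ mdeg \<alpha>"] c by (simp add: expands_def algebra_simps)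
  qed (use c in \<open>auto simp: expands_def\<close>)
  moreover have "((\<lambda>\<alpha>. mpow x \<alpha> *\<^sub>R T (c \<alpha>)) has_sum T (g x)) UNIV" if "x \<in> closed_cube r" for x
    using has_sum_bounded_linear[OF T, where f = "\<lambda>\<alpha>. mpow x \<alpha> *\<^sub>R c \<alpha>" and S = "g x" and A = UNIV] c that
    by (simp add: expands_def T.scaleR)
  ultimately show ?thesis using c by (auto simp: pseries_def expands_def)
qed

lemma pseries_cmult:
  fixes g :: "real ^ 'k::finite \<Rightarrow> 'a::{real_normed_algebra, banach}"
  assumes "pseries r C g"
  shows "pseries r (norm a * C) (\<lambda>x. a * g x)"
  by (rule pseries_bounded_linear[OF assms bounded_linear_mult_right]) (auto simp: norm_mult_ineq)

lemma pseries_scaleR_left: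
  assumes "pseries r C g"
  shows "pseries r (C * norm a) (\<lambda>x. g x *\<^sub>R a)"
  using pseries_bounded_linear[OF assms bounded_linear_scaleR_left[of a], of "norm a"]
  by (simp add: mult.commute)

lemma pseries_uminus: "pseries r C g \<Longrightarrow> pseries r C (\<lambda>x. - g x)"
  using pseries_bounded_linear[of r C g uminus 1] bounded_linear_minus[OF bounded_linear_ident] by simp

lemma pseries_diff: "pseries r C g \<Longrightarrow> pseries r D h \<Longrightarrow> pseries r (C + D) (\<lambda>x. g x - h x)"
  using pseries_add[OF _ pseries_uminus, of r C g D h] by simp

text \<open>The Cauchy product, obtained one factor at a time: multiplication of \<open>h\<close> by a single monomial
  shifts the exponents, and the terms of \<open>g\<close> are then summed.\<close>

lemma pseries_mult:
  fixes g h :: "real ^ 'k::finite \<Rightarrow> 'a::{real_normed_algebra, banach}"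
  assumes g: "pseries r C g" and h: "pseries r D h"
  shows "pseries r (C * D) (\<lambda>x. g x * h x)"
proof -
  obtain c where c: "expands r C c g" using g by (auto simp: pseries_def)
  have r: "0 < r" using c by (simp add: expands_def)
  show ?thesis
  proof (rule pseries_infsum[where J = UNIV and h = "\<lambda>\<alpha> x. mpow x \<alpha> *\<^sub>R (c \<alpha> * h x)"
        and D = "\<lambda>\<alpha>. norm (c \<alpha>) * r ^ mdeg \<alpha> * D"])
    show "sums_below (\<lambda>\<alpha>. norm (c \<alpha>) * r ^ mdeg \<alpha> * D) UNIV (C * D)"
      using sums_below_cmult[of "\<lambda>\<alpha>. norm (c \<alpha>) * r ^ mdeg \<alpha>" UNIV C D] c pseries_nonneg[OF h]
      by (simp add: expands_def mult.commute)
    show "pseries r (norm (c \<alpha>) * r ^ mdeg \<alpha> * D) (\<lambda>x. mpow x \<alpha> *\<^sub>R (c \<alpha> * h x))" for \<alpha>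
    proof -
      obtain d where d: "expands r D d h" using h by (auto simp: pseries_def)
      show ?thesis
      proof (rule pseries_regroup[where I = UNIV and a = "\<lambda>\<beta>. c \<alpha> * d \<beta>" and e = "\<lambda>\<beta> k. \<alpha> k + \<beta> k"])
        show "sums_below (\<lambda>\<beta>. norm (c \<alpha> * d \<beta>) * r ^ mdeg (\<lambda>k. \<alpha> k + \<beta> k)) UNIV
                 (norm (c \<alpha>) * r ^ mdeg \<alpha> * D)"
        proof (rule sums_below_mono[OF sums_below_cmult])
          show "sums_below (\<lambda>\<beta>. norm (d \<beta>) * r ^ mdeg \<beta>) UNIV D" using d by (simp add: expands_def)
          show "norm (c \<alpha> * d \<beta>) * r ^ mdeg (\<lambda>k. \<alpha> k + \<beta> k)
              \<le> norm (c \<alpha>) * r ^ mdeg \<alpha> * (norm (d \<beta>) * r ^ mdeg \<beta>)" for \<beta>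
            using mult_right_mono[OF norm_mult_ineq[of "c \<alpha>" "d \<beta>"], of "r ^ mdeg \<alpha> * r ^ mdeg \<beta>"] r
            by (simp add: mdeg_add power_add algebra_simps)
        qed (use r in auto)
        fix x :: "real ^ 'k" assume x: "x \<in> closed_cube r"
        have bl: "bounded_linear (\<lambda>y. mpow x \<alpha> *\<^sub>R (c \<alpha> * y))"
          by (intro bounded_linear_intros)
        have "((\<lambda>\<beta>. mpow x \<alpha> *\<^sub>R (c \<alpha> * (mpow x \<beta> *\<^sub>R d \<beta>))) has_sum mpow x \<alpha> *\<^sub>R (c \<alpha> * h x)) UNIV"
          by (rule has_sum_bounded_linear[OF bl]) (use d x in \<open>auto simp: expands_def\<close>)
        then show "((\<lambda>\<beta>. mpow x (\<lambda>k. \<alpha> k + \<beta> k) *\<^sub>R (c \<alpha> * d \<beta>)) has_sum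
                     mpow x \<alpha> *\<^sub>R (c \<alpha> * h x)) UNIV"
          by (simp add: mpow_add)
      qed (rule r)
    qed
    show "((\<lambda>\<alpha>. mpow x \<alpha> *\<^sub>R (c \<alpha> * h x)) has_sum g x * h x) UNIV" if "x \<in> closed_cube r" for x
      using has_sum_bounded_linear[OF bounded_linear_mult_left[of "h x"], where f = "\<lambda>\<alpha>. mpow x \<alpha> *\<^sub>R c \<alpha>" and S = "g x" and A = UNIV]
        c that by (simp add: expands_def)
  qed (rule r)
qed

lemma pseries_power:
  fixes g :: "real ^ 'k::finite \<Rightarrow> 'a::{real_normed_algebra_1, banach}"
  assumes "pseries r C g"
  shows "pseries r (C ^ n) (\<lambda>x. g x ^ n)"
proof (induction n)
  case 0
  show ?case using pseries_const[OF pseries_pos[OF assms], of "1::'a"] by simp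
next
  case (Suc n)
  show ?case using pseries_mult[OF assms Suc] by simp
qed

lemma pseries_prod:
  fixes g :: "'j \<Rightarrow> real ^ 'k::finite \<Rightarrow> 'a::{real_normed_algebra_1, banach, comm_monoid_mult}"
  assumes "0 < r" "finite J" "\<And>j. j \<in> J \<Longrightarrow> pseries r (C j) (g j)"
  shows "pseries r (prod C J) (\<lambda>x. \<Prod>j\<in>J. g j x)"
  using assms(2,3)
proof (induction J)
  case empty
  show ?case using pseries_const[OF assms(1), of "1::'a"] by simp
next
  case (insert j J)
  then show ?case using pseries_mult[of r "C j" "g j" "prod C J"] by simp
qed

lemma pseries_mpow:
  assumes "0 < r" "\<And>k. pseries r s (\<lambda>x. u x $ k)"
  shows "pseries r (s ^ mdeg \<alpha>) (\<lambda>x. mpow (u x) \<alpha>)"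
  using pseries_prod[OF assms(1), of UNIV "\<lambda>k. s ^ \<alpha> k" "\<lambda>k x. (u x $ k) ^ \<alpha> k"]
    pseries_power[OF assms(2)] by (simp add: mpow_def prod_const_power)

lemma pseries_in_cube:
  assumes "\<And>k. pseries r s (\<lambda>x. u x $ k)" "x \<in> closed_cube r"
  shows "u x \<in> closed_cube s"
  using pseries_norm_le[OF assms] by (simp add: closed_cube_def)

text \<open>The radius \<open>s\<close> of the outer series is the norm bound of the inner ones, so that \<open>u\<^sup>\<alpha>\<close> has norm
  at most \<open>s\<^bsup>\<bar>\<alpha>\<bar>\<^esup>\<close>, which is the weight that the norm of \<open>g\<close> gives to its coefficient.\<close>

lemma pseries_compose:
  assumes g: "pseries s C g" and u: "\<And>k. pseries r s (\<lambda>x. u x $ k)"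
  shows "pseries r C (\<lambda>x. g (u x))"
proof -
  obtain c where c: "expands s C c g" using g by (auto simp: pseries_def)
  have r: "0 < r" using u pseries_pos by blast
  show ?thesis
  proof (rule pseries_infsum[OF r, where J = UNIV])
    show "pseries r (s ^ mdeg \<alpha> * norm (c \<alpha>)) (\<lambda>x. mpow (u x) \<alpha> *\<^sub>R c \<alpha>)" for \<alpha>
      by (intro pseries_scaleR_left pseries_mpow r u)
    show "sums_below (\<lambda>\<alpha>. s ^ mdeg \<alpha> * norm (c \<alpha>)) UNIV C"
      using c by (simp add: expands_def mult.commute)
    show "((\<lambda>\<alpha>. mpow (u x) \<alpha> *\<^sub>R c \<alpha>) has_sum g (u x)) UNIV" if "x \<in> closed_cube r" for x
      using c pseries_in_cube[OF u that] by (simp add: expands_def)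
  qed
qed

text \<open>Re-expansion around another point of the cube is composition with a translation.\<close>

lemma pseries_translate:
  assumes g: "pseries R C g" and p: "\<And>k. \<bar>p $ k\<bar> + r \<le> R" and r: "0 < r"
  shows "pseries r C (\<lambda>x. g (p + x))"
proof (rule pseries_compose[OF g])
  show "pseries r R (\<lambda>x. (p + x) $ k)" for k
    using pseries_mono[OF pseries_add[OF pseries_const[OF r, of "p $ k"] pseries_coord[OF r, of k]] r order_refl, of R] p[of k]
    by simp
qed

lemma pseries_vec:
  fixes g :: "real ^ 'k::finite \<Rightarrow> real ^ 'm::finite"
  assumes "0 < r" "\<And>i. pseries r C (\<lambda>x. g x $ i)"
  shows "pseries r (real CARD('m) * C) g"
proof -
  have "pseries r (\<Sum>i\<in>(UNIV::'m set). C * norm (axis i 1 :: real ^ 'm)) (\<lambda>x. \<Sum>i\<in>UNIV. g x $ i *\<^sub>R (axis i 1 :: real ^ 'm))"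
    by (intro pseries_sum pseries_scaleR_left assms) auto
  then show ?thesis
    by (simp add: scalar_mult_eq_scaleR[symmetric] basis_expansion norm_axis_1)
qed

text \<open>The partial sums converge uniformly on the cube by the Weierstrass test.\<close>

lemma pseries_isCont:
  assumes g: "pseries r C g" and x: "\<And>k. \<bar>x $ k\<bar> < r"
  shows "isCont g x"
proof -
  obtain c where c: "expands r C c g" using g by (auto simp: pseries_def)
  have r: "0 < r" using c by (simp add: expands_def)
  have u: "uniform_limit (closed_cube r) (\<lambda>F x. \<Sum>\<alpha>\<in>F. mpow x \<alpha> *\<^sub>R c \<alpha>) g (finite_subsets_at_top UNIV)"
  proof (rule Weierstrass_m_test_general'[where M = "\<lambda>\<alpha>. norm (c \<alpha>) * r ^ mdeg \<alpha>"])
    show "norm (mpow x \<alpha> *\<^sub>R c \<alpha>) \<le> norm (c \<alpha>) * r ^ mdeg \<alpha>" if "x \<in> closed_cube r" for x \<alpha>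
      using mult_right_mono[OF abs_mpow_le[OF that, of \<alpha>], of "norm (c \<alpha>)"]
      by (simp add: mult.commute)
    show "(\<lambda>\<alpha>. norm (c \<alpha>) * r ^ mdeg \<alpha>) summable_on UNIV"
      by (rule sums_below_summable) (use c r in \<open>auto simp: expands_def\<close>)
  qed (use c in \<open>auto simp: expands_def\<close>)
  have cont: "continuous_on (closed_cube r) g"
  proof (rule uniform_limit_theorem[OF _ u])
    show "\<forall>\<^sub>F F in finite_subsets_at_top UNIV. continuous_on (closed_cube r) (\<lambda>x. \<Sum>\<alpha>\<in>F. mpow x \<alpha> *\<^sub>R c \<alpha>)"
      unfolding mpow_def by (intro always_eventually allI continuous_intros)
  qed simp
  have "x \<in> interior (closed_cube r)"
  proof (rule interiorI)
    show "open (\<Inter>k. {y. \<bar>y $ k\<bar> < r} :: (real ^ 'a) set)"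
      by (intro open_INT ballI open_Collect_less continuous_intros) simp
    show "x \<in> (\<Inter>k. {y. \<bar>y $ k\<bar> < r})" using x by auto
    show "(\<Inter>k. {y. \<bar>y $ k\<bar> < r}) \<subseteq> closed_cube r" by (auto simp: closed_cube_def less_imp_le)
  qed
  then show ?thesis using cont continuous_on_interior by blast
qed

section \<open>Low-order terms and contraction\<close>

lemma has_sum_diff:
  fixes f g :: "'i \<Rightarrow> 'a::topological_ab_group_add"
  assumes "(f has_sum a) I" "(g has_sum b) I"
  shows "((\<lambda>i. f i - g i) has_sum (a - b)) I"
  using has_sum_add[OF assms(1), of "\<lambda>i. - g i" "- b"] assms(2) by (simp add: has_sum_uminus)

definition unit_exp :: "'k \<Rightarrow> 'k \<Rightarrow> nat" where
  "unit_exp k = (\<lambda>i. if i = k then 1 else 0)"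

lemma mdeg_less_2_iff: "mdeg \<alpha> < 2 \<longleftrightarrow> \<alpha> = (\<lambda>_. 0) \<or> (\<exists>k. \<alpha> = unit_exp k)"
proof
  assume *: "mdeg \<alpha> < 2"
  show "\<alpha> = (\<lambda>_. 0) \<or> (\<exists>k. \<alpha> = unit_exp k)"
  proof (cases "\<alpha> = (\<lambda>_. 0)")
    case False
    then obtain k where k: "\<alpha> k \<noteq> 0" by auto
    have split: "mdeg \<alpha> = \<alpha> k + (\<Sum>i\<in>UNIV - {k}. \<alpha> i)"
      unfolding mdeg_def by (rule sum.remove) auto
    then have "\<alpha> k = 1" "(\<Sum>i\<in>UNIV - {k}. \<alpha> i) = 0" using k * by linarith+
    then have "\<alpha> = unit_exp k" unfolding unit_exp_def by (intro ext) (auto simp: sum_nonneg_eq_0_iff)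
    then show ?thesis by blast
  qed simp
next
  assume "\<alpha> = (\<lambda>_. 0) \<or> (\<exists>k. \<alpha> = unit_exp k)"
  then show "mdeg \<alpha> < 2" by (auto simp: mdeg_single unit_exp_def)
qed

lemma mpow_unit_exp [simp]: "mpow x (unit_exp k) = x $ k"
  by (simp only: unit_exp_def mpow_single)

lemma inj_unit_exp: "inj unit_exp"
proof (rule injI)
  fix k l :: 'a assume "unit_exp k = unit_exp l"
  from fun_cong[OF this, of k] show "k = l" by (simp add: unit_exp_def split: if_splits)
qed

lemma sum_mdeg_less_2:
  fixes h :: "('k::finite \<Rightarrow> nat) \<Rightarrow> 'a::comm_monoid_add"
  shows "(\<Sum>\<alpha> | mdeg \<alpha> < 2. h \<alpha>) = h (\<lambda>_. 0) + (\<Sum>k\<in>UNIV. h (unit_exp k))"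
    and finite_mdeg_less_2: "finite {\<alpha> :: 'k \<Rightarrow> nat. mdeg \<alpha> < 2}"
proof -
  have eq: "{\<alpha> :: 'k \<Rightarrow> nat. mdeg \<alpha> < 2} = insert (\<lambda>_. 0) (range unit_exp)"
    by (auto simp: mdeg_less_2_iff)
  show "finite {\<alpha> :: 'k \<Rightarrow> nat. mdeg \<alpha> < 2}" by (simp add: eq)
  have "(\<lambda>_. 0) \<notin> range (unit_exp :: 'k \<Rightarrow> _)"
  proof
    assume "(\<lambda>_. 0) \<in> range (unit_exp :: 'k \<Rightarrow> _)"
    then obtain k :: 'k where "(\<lambda>_. 0) = unit_exp k" by auto
    from fun_cong[OF this, of k] show False by (simp add: unit_exp_def)
  qed
  then show "(\<Sum>\<alpha> | mdeg \<alpha> < 2. h \<alpha>) = h (\<lambda>_. 0) + (\<Sum>k\<in>UNIV. h (unit_exp k))"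
    by (simp add: eq sum.reindex[OF inj_unit_exp])
qed

lemma expands_remainder:
  assumes "expands r C c g"
  shows "expands r C (\<lambda>\<alpha>. if mdeg \<alpha> < 2 then 0 else c \<alpha>)
           (\<lambda>x. g x - (c (\<lambda>_. 0) + (\<Sum>k\<in>UNIV. x $ k *\<^sub>R c (unit_exp k))))"
proof -
  have "sums_below (\<lambda>\<alpha>. norm (if mdeg \<alpha> < 2 then 0 else c \<alpha>) * r ^ mdeg \<alpha>) UNIV C"
    by (rule sums_below_mono[where b = "\<lambda>\<alpha>. norm (c \<alpha>) * r ^ mdeg \<alpha>" and C = C])
       (use assms in \<open>auto simp: expands_def\<close>)
  moreover have "((\<lambda>\<alpha>. mpow x \<alpha> *\<^sub>R (if mdeg \<alpha> < 2 then 0 else c \<alpha>)) has_sum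
      g x - (c (\<lambda>_. 0) + (\<Sum>k\<in>UNIV. x $ k *\<^sub>R c (unit_exp k)))) UNIV" if "x \<in> closed_cube r" for x
  proof -
    have "((\<lambda>\<alpha>. if mdeg \<alpha> < 2 then mpow x \<alpha> *\<^sub>R c \<alpha> else 0) has_sum
        (\<Sum>\<alpha> | mdeg \<alpha> < 2. if mdeg \<alpha> < 2 then mpow x \<alpha> *\<^sub>R c \<alpha> else 0)) UNIV"
      by (rule has_sum_finite_neutralI[OF finite_mdeg_less_2]) auto
    moreover have "((\<lambda>\<alpha>. mpow x \<alpha> *\<^sub>R c \<alpha>) has_sum g x) UNIV"
      using assms that by (simp add: expands_def)
    ultimately have "((\<lambda>\<alpha>. mpow x \<alpha> *\<^sub>R c \<alpha> - (if mdeg \<alpha> < 2 then mpow x \<alpha> *\<^sub>R c \<alpha> else 0)) has_sum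
        g x - (\<Sum>\<alpha> | mdeg \<alpha> < 2. if mdeg \<alpha> < 2 then mpow x \<alpha> *\<^sub>R c \<alpha> else 0)) UNIV"
      by (intro has_sum_diff)
    moreover have "(\<lambda>\<alpha>. mpow x \<alpha> *\<^sub>R c \<alpha> - (if mdeg \<alpha> < 2 then mpow x \<alpha> *\<^sub>R c \<alpha> else 0))
        = (\<lambda>\<alpha>. mpow x \<alpha> *\<^sub>R (if mdeg \<alpha> < 2 then 0 else c \<alpha>))" by auto
    moreover have "(\<Sum>\<alpha> | mdeg \<alpha> < 2. if mdeg \<alpha> < 2 then mpow x \<alpha> *\<^sub>R c \<alpha> else 0)
        = c (\<lambda>_. 0) + (\<Sum>k\<in>UNIV. x $ k *\<^sub>R c (unit_exp k))"
      using sum_mdeg_less_2(1)[of "\<lambda>\<alpha>. mpow x \<alpha> *\<^sub>R c \<alpha>"] by simp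
    ultimately show ?thesis by simp
  qed
  ultimately show ?thesis using assms by (simp add: expands_def)
qed

text \<open>If the expansion starts in degree \<open>m\<close>, scaling the cube by \<open>t\<close> scales the norm by at most
  \<open>t\<^sup>m\<close>. This is how series without low-order terms are made small.\<close>

lemma expands_shrink:
  assumes c: "expands r C c g" and van: "\<And>\<alpha>. mdeg \<alpha> < m \<Longrightarrow> c \<alpha> = 0" and t: "0 < t" "t \<le> 1"
  shows "expands (t * r) (t ^ m * C) c g"
proof -
  have r: "0 < r" using c by (simp add: expands_def)
  have "sums_below (\<lambda>\<alpha>. norm (c \<alpha>) * (t * r) ^ mdeg \<alpha>) UNIV (t ^ m * C)"
  proof (rule sums_below_mono[OF sums_below_cmult])
    show "sums_below (\<lambda>\<alpha>. norm (c \<alpha>) * r ^ mdeg \<alpha>) UNIV C" using c by (simp add: expands_def)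
    show "norm (c \<alpha>) * (t * r) ^ mdeg \<alpha> \<le> t ^ m * (norm (c \<alpha>) * r ^ mdeg \<alpha>)" for \<alpha>
    proof (cases "mdeg \<alpha> < m")
      case False
      then have "t ^ mdeg \<alpha> \<le> t ^ m" using t by (intro power_decreasing) auto
      then have "norm (c \<alpha>) * r ^ mdeg \<alpha> * t ^ mdeg \<alpha> \<le> norm (c \<alpha>) * r ^ mdeg \<alpha> * t ^ m"
        by (rule mult_left_mono) (use r in auto)
      then show ?thesis by (simp add: power_mult_distrib algebra_simps)
    qed (simp add: van)
  qed (use t in auto)
  moreover have "t * r \<le> r" using r t by (simp add: mult_left_le_one_le)
  ultimately show ?thesis using c t closed_cube_mono[OF \<open>t * r \<le> r\<close>] by (auto simp: expands_def)
qed

lemma expands_at_0: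
  fixes g :: "real ^ 'k::finite \<Rightarrow> 'a::banach"
  assumes "expands r C c g" shows "g 0 = c (\<lambda>_. 0)"
proof -
  have 0: "mpow (0 :: real ^ 'k) \<alpha> = 0" if "\<alpha> \<noteq> (\<lambda>_. 0)" for \<alpha>
  proof -
    have "\<not> (\<forall>k. \<alpha> k = 0)" using that by (simp add: fun_eq_iff)
    then obtain k where "\<alpha> k \<noteq> 0" by blast
    then have "((0 :: real ^ 'k) $ k) ^ \<alpha> k = 0" by simp
    then show ?thesis unfolding mpow_def by (intro prod_zero finite bexI[of _ k]) auto
  qed
  have "((\<lambda>\<alpha>. mpow 0 \<alpha> *\<^sub>R c \<alpha>) has_sum c (\<lambda>_. 0)) UNIV"
    by (rule has_sum_finite_neutralI[where B = "{\<lambda>_. 0}"]) (auto simp: 0)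
  moreover have "((\<lambda>\<alpha>. mpow 0 \<alpha> *\<^sub>R c \<alpha>) has_sum g 0) UNIV"
    using assms by (auto simp: expands_def closed_cube_def)
  ultimately show ?thesis using has_sum_unique by blast
qed

lemma expands_pseries: "expands r C c g \<Longrightarrow> pseries r C g"
  by (auto simp: pseries_def)

lemma norm_in_cube: "x \<in> closed_cube (norm x)"
  by (simp add: closed_cube_def component_le_norm_cart)

lemma expands_quadratic_bound:
  assumes c: "expands r C c g" and van: "\<And>\<alpha>. mdeg \<alpha> < 2 \<Longrightarrow> c \<alpha> = 0" and x: "norm x \<le> r"
  shows "norm (g x) \<le> C / r\<^sup>2 * (norm x)\<^sup>2"
proof (cases "x = 0")
  case True
  then show ?thesis using expands_at_0[OF c] van[of "\<lambda>_. 0"] by simp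
next
  case False
  have r: "0 < r" using c by (simp add: expands_def)
  have "expands (norm x / r * r) ((norm x / r)\<^sup>2 * C) c g"
    by (rule expands_shrink[OF c van]) (use False x r in auto)
  then have "norm (g x) \<le> (norm x / r)\<^sup>2 * C"
    using r by (intro pseries_norm_le[OF expands_pseries]) (auto intro: norm_in_cube)
  then show ?thesis by (simp add: power_divide mult.commute)
qed

text \<open>The remainder after the terms of degree at most \<open>1\<close> is bounded by a multiple of \<open>\<parallel>x\<parallel>\<^sup>2\<close>, hence the
  linear part of the expansion is the derivative.\<close>

lemma expands_has_derivative:
  fixes g :: "real ^ 'k::finite \<Rightarrow> 'a::banach"
  assumes c: "expands r C c g"
  shows "(g has_derivative (\<lambda>h. \<Sum>k\<in>UNIV. h $ k *\<^sub>R c (unit_exp k))) (at 0)"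
proof -
  have r: "0 < r" using c by (simp add: expands_def)
  define c2 where "c2 = (\<lambda>\<alpha>. if mdeg \<alpha> < 2 then 0 else c \<alpha>)"
  define L where "L = (\<lambda>h. \<Sum>k\<in>UNIV. h $ k *\<^sub>R c (unit_exp k))"
  define N where "N = (\<lambda>x. g x - (c (\<lambda>_. 0) + L x))"
  have N: "expands r C c2 N"
    using expands_remainder[OF c] by (simp add: c2_def N_def L_def)
  have bd: "norm (N x) \<le> C / r\<^sup>2 * (norm x)\<^sup>2" if "norm x \<le> r" for x
    by (rule expands_quadratic_bound[OF N _ that]) (simp add: c2_def)
  have L: "bounded_linear L"
    unfolding L_def by (intro bounded_linear_sum bounded_linear_compose[OF bounded_linear_scaleR_left] bounded_linear_vec_nth)
  have "((\<lambda>y. (1 / norm (y - 0)) *\<^sub>R (g y - (g 0 + L (y - 0)))) \<longlongrightarrow> 0) (at 0)"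
  proof (rule Lim_null_comparison)
    show "\<forall>\<^sub>F y in at 0. norm ((1 / norm (y - 0)) *\<^sub>R (g y - (g 0 + L (y - 0)))) \<le> C / r\<^sup>2 * norm y"
      unfolding eventually_at
    proof (intro exI[of _ r] conjI ballI impI)
      fix y :: "real ^ 'k" assume y: "y \<noteq> 0 \<and> dist y 0 < r"
      have "norm ((1 / norm (y - 0)) *\<^sub>R (g y - (g 0 + L (y - 0)))) = norm (N y) / norm y"
        by (simp add: N_def expands_at_0[OF c])
      also have "\<dots> \<le> C / r\<^sup>2 * norm y"
        using bd[of y] y r by (simp add: pos_divide_le_eq power2_eq_square mult.assoc)
      finally show "norm ((1 / norm (y - 0)) *\<^sub>R (g y - (g 0 + L (y - 0)))) \<le> C / r\<^sup>2 * norm y" .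
    qed (rule r)
    show "((\<lambda>y. C / r\<^sup>2 * norm y) \<longlongrightarrow> 0) (at 0)"
      using tendsto_mult[OF tendsto_const tendsto_norm_zero[OF tendsto_ident_at], of "C / r\<^sup>2"] by simp
  qed
  then have "(g has_derivative L) (at 0)"
    using L by (simp add: has_derivative_at2)
  then show ?thesis by (simp add: L_def)
qed

lemma leibniz_bound_identity:
  fixes s \<delta> :: real
  shows "s ^ m * (\<delta> * real n * s ^ (n - 1)) + (\<delta> * real m * s ^ (m - 1)) * s ^ n
         = \<delta> * real (m + n) * s ^ (m + n - 1)"
  by (cases m; cases n) (simp_all add: algebra_simps power_add)

text \<open>Two power series that behave like products of \<open>m\<close> pairs of factors, where all factors have norm at
  most \<open>s\<close> and paired factors differ by at most \<open>\<delta>\<close>: the bound on the difference is \<open>\<delta>\<close> times the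
  derivative of \<open>s\<^sup>m\<close> (which is \<open>0\<close> for \<open>m = 0\<close>, in spite of the truncated
  exponent). The Leibniz rule makes the relation multiplicative.\<close>

definition degree_close where
  "degree_close r s \<delta> m a b \<longleftrightarrow> pseries r (s ^ m) a \<and> pseries r (s ^ m) b \<and>
     pseries r (\<delta> * real m * s ^ (m - 1)) (\<lambda>x. a x - b x)"

lemma degree_close_mult:
  fixes a b a' b' :: "real ^ 'k::finite \<Rightarrow> real"
  assumes "degree_close r s \<delta> m a b" "degree_close r s \<delta> n a' b'"
  shows "degree_close r s \<delta> (m + n) (\<lambda>x. a x * a' x) (\<lambda>x. b x * b' x)"
proof -
  have "pseries r (s ^ m * (\<delta> * real n * s ^ (n - 1)) + (\<delta> * real m * s ^ (m - 1)) * s ^ n)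
     (\<lambda>x. a x * (a' x - b' x) + (a x - b x) * b' x)"
    by (intro pseries_add pseries_mult) (use assms in \<open>auto simp: degree_close_def\<close>)
  then have "pseries r (\<delta> * real (m + n) * s ^ (m + n - 1)) (\<lambda>x. a x * a' x - b x * b' x)"
    unfolding leibniz_bound_identity by (simp add: algebra_simps)
  then show ?thesis
    using assms by (auto simp: degree_close_def power_add intro: pseries_mult)
qed

lemma degree_close_0:
  assumes "0 < r" shows "degree_close r s \<delta> 0 (\<lambda>_. 1::real) (\<lambda>_. 1)"
  using pseries_const[OF assms, of "1::real"] pseries_const[OF assms, of "0::real"]
  by (simp add: degree_close_def)

lemma degree_close_mpow:
  fixes u v :: "real ^ 'k::finite \<Rightarrow> real ^ 'm::finite"
  assumes r: "0 < r" and u: "\<And>k. pseries r s (\<lambda>x. u x $ k)" and v: "\<And>k. pseries r s (\<lambda>x. v x $ k)"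
    and uv: "\<And>k. pseries r \<delta> (\<lambda>x. u x $ k - v x $ k)"
  shows "degree_close r s \<delta> (mdeg \<alpha>) (\<lambda>x. mpow (u x) \<alpha>) (\<lambda>x. mpow (v x) \<alpha>)"
proof -
  have 1: "degree_close r s \<delta> 1 (\<lambda>x. u x $ k) (\<lambda>x. v x $ k)" for k
    using u v uv by (simp add: degree_close_def)
  have pow: "degree_close r s \<delta> n (\<lambda>x. (u x $ k) ^ n) (\<lambda>x. (v x $ k) ^ n)" for k n
  proof (induction n)
    case 0
    show ?case using degree_close_0[OF r] by simp
  next
    case (Suc n)
    show ?case using degree_close_mult[OF 1 Suc, of k] by simp
  qed
  have "degree_close r s \<delta> (\<Sum>k\<in>A. \<alpha> k) (\<lambda>x. \<Prod>k\<in>A. (u x $ k) ^ \<alpha> k) (\<lambda>x. \<Prod>k\<in>A. (v x $ k) ^ \<alpha> k)"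
    if "finite A" for A
    using that
  proof (induction A)
    case empty
    show ?case using degree_close_0[OF r] by simp
  next
    case (insert k A)
    then show ?case using degree_close_mult[OF pow[of "\<alpha> k" k] insert.IH] by simp
  qed
  then show ?thesis by (simp add: mdeg_def mpow_def)
qed

text \<open>Bounds the derivative of \<open>s\<^sup>d\<close> by the weight \<open>R\<^sup>d\<close>, with a factor proportional to \<open>s\<close>. Such a
  factor is available only for \<open>d \<ge> 2\<close>; it makes the contraction constant small for small \<open>s\<close>.\<close>

lemma quadratic_weight_bound:
  assumes s: "0 < s" "s \<le> R / 2" and d: "2 \<le> d"
  shows "real d * s ^ (d - 1) \<le> 2 * s / R\<^sup>2 * R ^ d"
proof -
  obtain n where n: "d = n + 2" using d by (metis add.commute le_Suc_ex)
  have R: "0 < R" using s by linarith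
  have "real (n + 2) \<le> 2 * 2 ^ n" by (induction n) auto
  moreover have "s ^ n \<le> (R / 2) ^ n" using s by (intro power_mono) auto
  ultimately have "real (n + 2) * s ^ n \<le> 2 * 2 ^ n * (R / 2) ^ n"
    using s by (intro mult_mono) auto
  also have "\<dots> = 2 * R ^ n" by (simp add: power_divide)
  finally have "s * (real (n + 2) * s ^ n) \<le> s * (2 * R ^ n)"
    using s by (intro mult_left_mono) auto
  then show ?thesis using R by (simp add: n power_add power2_eq_square algebra_simps)
qed

text \<open>Substitution into a series without terms of degree at most \<open>1\<close> contracts by the factor \<open>1/2\<close> once
  \<open>s\<close> is small: term by term, \<open>u\<^sup>\<alpha> - v\<^sup>\<alpha>\<close> has norm at most \<open>\<delta> \<bar>\<alpha>\<bar> s\<^bsup>\<bar>\<alpha>\<bar>-1\<^esup>\<close>.\<close>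

lemma quadratic_contraction:
  fixes u v :: "real ^ 'k::finite \<Rightarrow> real ^ 'm::finite"
  assumes c: "expands R C c N" and van: "\<And>\<alpha>. mdeg \<alpha> < 2 \<Longrightarrow> c \<alpha> = 0"
    and s: "0 < s" "s \<le> R / 2" and sC: "4 * s * C \<le> R\<^sup>2"
    and u: "\<And>k. pseries r s (\<lambda>x. u x $ k)" and v: "\<And>k. pseries r s (\<lambda>x. v x $ k)"
    and uv: "\<And>k. pseries r \<delta> (\<lambda>x. u x $ k - v x $ k)"
  shows "pseries r (\<delta> / 2) (\<lambda>x. N (u x) - N (v x))"
proof -
  have r: "0 < r" and \<delta>: "0 \<le> \<delta>" using uv pseries_pos pseries_nonneg by blast+
  have R: "0 < R" using c by (simp add: expands_def)
  show ?thesis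
  proof (rule pseries_infsum[OF r, where J = UNIV
        and h = "\<lambda>\<alpha> x. (mpow (u x) \<alpha> - mpow (v x) \<alpha>) *\<^sub>R c \<alpha>"])
    show "pseries r (\<delta> * real (mdeg \<alpha>) * s ^ (mdeg \<alpha> - 1) * norm (c \<alpha>))
        (\<lambda>x. (mpow (u x) \<alpha> - mpow (v x) \<alpha>) *\<^sub>R c \<alpha>)" for \<alpha>
      using degree_close_mpow[OF r u v uv, where \<alpha> = \<alpha>]
      by (intro pseries_scaleR_left) (simp add: degree_close_def)
    show "sums_below (\<lambda>\<alpha>. \<delta> * real (mdeg \<alpha>) * s ^ (mdeg \<alpha> - 1) * norm (c \<alpha>)) UNIV (\<delta> / 2)"
    proof (rule sums_below_mono[OF sums_below_cmult])
      show "sums_below (\<lambda>\<alpha>. norm (c \<alpha>) * R ^ mdeg \<alpha>) UNIV C" using c by (simp add: expands_def)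
      show "\<delta> * real (mdeg \<alpha>) * s ^ (mdeg \<alpha> - 1) * norm (c \<alpha>) \<le>
          \<delta> * (2 * s / R\<^sup>2) * (norm (c \<alpha>) * R ^ mdeg \<alpha>)" for \<alpha>
      proof (cases "mdeg \<alpha> < 2")
        case False
        then have "\<delta> * norm (c \<alpha>) * (real (mdeg \<alpha>) * s ^ (mdeg \<alpha> - 1))
           \<le> \<delta> * norm (c \<alpha>) * (2 * s / R\<^sup>2 * R ^ mdeg \<alpha>)"
          using \<delta> by (intro mult_left_mono quadratic_weight_bound s) auto
        then show ?thesis by (simp add: algebra_simps)
      qed (simp add: van)
      have "2 * s / R\<^sup>2 * C \<le> 1 / 2" using sC R by (simp add: divide_simps)
      then have "\<delta> * (2 * s / R\<^sup>2 * C) \<le> \<delta> * (1 / 2)" using \<delta> by (rule mult_left_mono)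
      then show "\<delta> * (2 * s / R\<^sup>2) * C \<le> \<delta> / 2" by simp
    qed (use \<delta> s in auto)
    fix x :: "real ^ 'k" assume x: "x \<in> closed_cube r"
    have sR: "s \<le> R" using s by linarith
    have "((\<lambda>\<alpha>. mpow (w x) \<alpha> *\<^sub>R c \<alpha>) has_sum N (w x)) UNIV"
      if "\<And>k. pseries r s (\<lambda>x. w x $ k)" for w :: "real ^ 'k \<Rightarrow> real ^ 'm"
      using c closed_cube_mono[OF sR pseries_in_cube[OF that x]] by (simp add: expands_def)
    from has_sum_diff[OF this[OF u] this[OF v]]
    show "((\<lambda>\<alpha>. (mpow (u x) \<alpha> - mpow (v x) \<alpha>) *\<^sub>R c \<alpha>) has_sum N (u x) - N (v x)) UNIV"
      by (simp add: scaleR_left_diff_distrib)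
  qed
qed

section \<open>The analytic inverse of a perturbation of the identity\<close>

definition open_cube :: "real \<Rightarrow> (real ^ 'k::finite) set" where
  "open_cube r = {x. \<forall>k. \<bar>x $ k\<bar> < r}"

lemma open_open_cube: "open (open_cube r :: (real ^ 'k::finite) set)"
proof -
  have "open_cube r = (\<Inter>k. {y. \<bar>y $ k\<bar> < r} :: (real ^ 'k) set)" by (auto simp: open_cube_def)
  moreover have "open (\<Inter>k. {y. \<bar>y $ k\<bar> < r} :: (real ^ 'k) set)"
    by (intro open_INT ballI open_Collect_less continuous_intros) simp
  ultimately show ?thesis by simp
qed

lemma open_cube_imp_closed_cube: "x \<in> open_cube r \<Longrightarrow> x \<in> closed_cube r"
  by (auto simp: open_cube_def closed_cube_def less_imp_le)

text \<open>The iteration \<open>\<Phi>\<^bsub>n+1\<^esub> = id - N \<circ> \<Phi>\<^sub>n\<close> from \<open>\<Phi>\<^sub>0 = 0\<close> stays in the norm ball of radius \<open>s\<close>, and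
  consecutive iterates differ by at most \<open>s / 2\<^sup>n\<close> in norm; the limit is summed as a telescoping
  series, which gives the norm bound \<open>2 s\<close>. Pointwise the limit stays in the cube of half-width \<open>s\<close>.
  Uniqueness is the contraction estimate once more, applied to constant functions.\<close>

lemma near_identity_inverse:
  fixes N :: "real ^ 'k::finite \<Rightarrow> real ^ 'k"
  assumes N: "\<And>k. pseries R C (\<lambda>x. N x $ k)" and N0: "N 0 = 0"
    and dN: "(N has_derivative (\<lambda>_. 0)) (at 0)"
  obtains s \<phi> where "0 < s" "s \<le> R / 2"
    "\<And>k. pseries (s / 2) (2 * s) (\<lambda>y. \<phi> y $ k)"
    "\<And>y. y \<in> closed_cube (s / 2) \<Longrightarrow> \<phi> y \<in> closed_cube s \<and> \<phi> y + N (\<phi> y) = y"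
    "\<And>x k. x \<in> closed_cube s \<Longrightarrow> \<bar>N x $ k\<bar> \<le> s / 4"
    "\<And>x x'. x \<in> closed_cube s \<Longrightarrow> x' \<in> closed_cube s \<Longrightarrow> x + N x = x' + N x' \<Longrightarrow> x = x'"
proof -
  have R: "0 < R" and C: "0 \<le> C" using N pseries_pos pseries_nonneg by blast+
  have "\<forall>k. \<exists>c. expands R C c (\<lambda>x. N x $ k)" using N by (auto simp: pseries_def)
  then obtain c where c: "\<And>k. expands R C (c k) (\<lambda>x. N x $ k)" by metis
  \<comment> \<open>Value and derivative at \<open>0\<close> are the coefficients of degree \<open>0\<close> and \<open>1\<close>.\<close>
  have van: "c k \<alpha> = 0" if "mdeg \<alpha> < 2" for k \<alpha>
  proof -
    have "((\<lambda>x. N x $ k) has_derivative (\<lambda>_. 0 $ k)) (at 0)"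
      by (rule bounded_linear.has_derivative[OF bounded_linear_vec_nth dN])
    then have "(\<lambda>h. \<Sum>i\<in>UNIV. h $ i *\<^sub>R c k (unit_exp i)) = (\<lambda>_. 0 $ k)"
      by (rule has_derivative_unique[OF expands_has_derivative[OF c]])
    then have "(\<Sum>i\<in>UNIV. axis j 1 $ i *\<^sub>R c k (unit_exp i)) = 0" for j by (metis zero_index)
    then have "c k (unit_exp j) = 0" for j by (simp add: axis_def if_distrib[of "\<lambda>x. x * _"] cong: if_cong)
    moreover have "c k (\<lambda>_. 0) = 0" using expands_at_0[OF c, of k] N0 by simp
    ultimately show ?thesis using that by (auto simp: mdeg_less_2_iff)
  qed
  \<comment> \<open>The second bound gives \<open>4 s C \<le> R\<^sup>2\<close>, as the contraction lemma requires; the summand \<open>1\<close>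
    avoids a division by zero when \<open>C = 0\<close>.\<close>
  define s where "s = min (R / 2) (R\<^sup>2 / (4 * (C + 1)))"
  have s: "0 < s" "s \<le> R / 2"
    using R C by (simp_all only: s_def min.cobounded1 min_less_iff_conj) simp
  have sC: "4 * s * C \<le> R\<^sup>2"
  proof -
    have "s \<le> R\<^sup>2 / (4 * (C + 1))" by (simp add: s_def)
    then have "s * (4 * (C + 1)) \<le> R\<^sup>2" using C by (simp add: pos_le_divide_eq)
    then show ?thesis using s by (simp add: algebra_simps)
  qed
  have contr: "pseries r (\<delta> / 2) (\<lambda>x. N (u x) $ k - N (v x) $ k)"
    if "\<And>k. pseries r s (\<lambda>x. u x $ k)" "\<And>k. pseries r s (\<lambda>x. v x $ k)"
      "\<And>k. pseries r \<delta> (\<lambda>x. u x $ k - v x $ k)" for r \<delta> k and u v :: "real ^ 'k \<Rightarrow> real ^ 'k"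
    by (rule quadratic_contraction[OF c van s sC that])
  have Ns: "pseries s (s / 4) (\<lambda>x. N x $ k)" for k
  proof -
    have "expands (s / R * R) ((s / R)\<^sup>2 * C) (c k) (\<lambda>x. N x $ k)"
      by (rule expands_shrink[OF c van]) (use s R in \<open>auto simp: field_simps\<close>)
    moreover have "(s / R)\<^sup>2 * C \<le> s / 4"
      using mult_left_mono[OF sC, of s] s R by (simp add: field_simps power2_eq_square)
    ultimately show ?thesis using R s(1) by (intro pseries_mono[OF expands_pseries]) auto
  qed
  define \<Phi> where "\<Phi> = rec_nat (\<lambda>_. 0) (\<lambda>_ \<phi> (y :: real ^ 'k). y - N (\<phi> y))"
  have \<Phi>0: "\<Phi> 0 = (\<lambda>_. 0)" and \<Phi>S: "\<Phi> (Suc n) = (\<lambda>y. y - N (\<Phi> n y))" for n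
    by (simp_all add: \<Phi>_def)
  have s2: "0 < s / 2" using s by simp
  have bound: "pseries (s / 2) s (\<lambda>y. \<Phi> n y $ k)" for n k
  proof (induction n arbitrary: k)
    case 0
    show ?case using pseries_mono[OF pseries_const[OF s2, of "0::real"] s2 order_refl, of s] s by (simp add: \<Phi>0)
  next
    case (Suc n)
    have "pseries (s / 2) (s / 2 + s / 4) (\<lambda>y. y $ k - N (\<Phi> n y) $ k)"
      by (intro pseries_diff pseries_coord s2 pseries_compose[OF Ns] Suc)
    then show ?case using s by (simp add: \<Phi>S) (rule pseries_mono, auto)
  qed
  have step: "pseries (s / 2) (s * (1/2) ^ n) (\<lambda>y. \<Phi> (Suc n) y $ k - \<Phi> n y $ k)" for n k
  proof (induction n arbitrary: k)
    case 0
    show ?case using bound[of "Suc 0" k] by (simp add: \<Phi>0)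
  next
    case (Suc n)
    have "pseries (s / 2) (s * (1/2) ^ n / 2) (\<lambda>y. N (\<Phi> (Suc n) y) $ k - N (\<Phi> n y) $ k)"
      by (intro contr bound Suc)
    from pseries_uminus[OF this] show ?case by (simp add: \<Phi>S[of "Suc n"] \<Phi>S[of n])
  qed
  define d where "d k y n = \<Phi> (Suc n) y $ k - \<Phi> n y $ k" for k y n
  define \<phi> where "\<phi> y = (\<chi> k. suminf (d k y))" for y
  have geo: "(\<lambda>n. s * (1/2) ^ n) sums (2 * s)"
    using sums_mult[OF geometric_sums[of "1/2::real"], of s] by (simp add: mult.commute)
  have dle: "norm (d k y n) \<le> s * (1/2) ^ n" if "y \<in> closed_cube (s / 2)" for k y n
    using pseries_norm_le[OF step that, of n k] by (simp add: d_def)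
  have dsumm: "summable (\<lambda>n. norm (d k y n))" if "y \<in> closed_cube (s / 2)" for k y
    by (rule summable_comparison_test'[OF sums_summable[OF geo], of 0]) (use dle[OF that] in simp)
  have dsums: "d k y sums (\<phi> y $ k)" if "y \<in> closed_cube (s / 2)" for k y
    using summable_sums[OF summable_norm_cancel[OF dsumm[OF that]]] by (simp add: \<phi>_def)
  have \<phi>ps: "pseries (s / 2) (2 * s) (\<lambda>y. \<phi> y $ k)" for k
  proof (rule pseries_infsum[OF s2, where J = UNIV])
    show "pseries (s / 2) (s * (1/2) ^ n) (\<lambda>y. d k y n)" for n
      unfolding d_def by (rule step)
    show "sums_below (\<lambda>n. s * (1/2) ^ n) UNIV (2 * s)"
    proof (rule sums_belowI)
      fix F :: "nat set" assume "finite F"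
      then show "(\<Sum>n\<in>F. s * (1/2) ^ n) \<le> 2 * s"
        using sum_le_suminf[OF sums_summable[OF geo], of F] sums_unique[OF geo] s by simp
    qed
    show "((\<lambda>n. d k y n) has_sum \<phi> y $ k) UNIV" if "y \<in> closed_cube (s / 2)" for y
      by (rule norm_summable_imp_has_sum[OF dsumm dsums]) (rule that)+
  qed
  have fixpt: "\<phi> y \<in> closed_cube s \<and> \<phi> y + N (\<phi> y) = y" if y: "y \<in> closed_cube (s / 2)" for y
  proof -
    have lim: "(\<lambda>n. \<Phi> n y) \<longlonglongrightarrow> \<phi> y"
    proof (rule vec_tendstoI)
      fix k
      have "(\<Sum>i<n. d k y i) = \<Phi> n y $ k" for n
        unfolding d_def by (subst sum_lessThan_telescope) (simp add: \<Phi>0)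
      then show "(\<lambda>n. \<Phi> n y $ k) \<longlonglongrightarrow> \<phi> y $ k" using dsums[OF y, of k] by (simp add: sums_def)
    qed
    have in_s: "\<Phi> n y \<in> closed_cube s" for n
      by (rule pseries_in_cube[OF bound y])
    have "\<bar>\<phi> y $ k\<bar> \<le> s" for k
    proof (rule LIMSEQ_le_const2)
      show "(\<lambda>n. \<bar>\<Phi> n y $ k\<bar>) \<longlonglongrightarrow> \<bar>\<phi> y $ k\<bar>" by (intro tendsto_intros lim)
      show "\<exists>N. \<forall>n\<ge>N. \<bar>\<Phi> n y $ k\<bar> \<le> s" using in_s by (auto simp: closed_cube_def)
    qed
    then have \<phi>s: "\<phi> y \<in> closed_cube s" by (simp add: closed_cube_def)
    have cont: "isCont (\<lambda>x. N x $ k) (\<phi> y)" for k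
    proof (rule pseries_isCont[OF N])
      show "\<bar>\<phi> y $ i\<bar> < R" for i using \<phi>s s R by (auto simp: closed_cube_def intro: le_less_trans)
    qed
    have "(\<lambda>n. N (\<Phi> n y)) \<longlonglongrightarrow> N (\<phi> y)"
      by (rule vec_tendstoI) (rule isCont_tendsto_compose[OF cont lim])
    then have "(\<lambda>n. \<Phi> (Suc n) y) \<longlonglongrightarrow> y - N (\<phi> y)"
      unfolding \<Phi>S by (intro tendsto_intros)
    then have "\<phi> y = y - N (\<phi> y)"
      using LIMSEQ_Suc[OF lim] LIMSEQ_unique by blast
    then show ?thesis using \<phi>s by (metis diff_add_cancel)
  qed
  have uniq: "x = x'" if xs: "x \<in> closed_cube s" "x' \<in> closed_cube s" and eq: "x + N x = x' + N x'" for x x'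
  proof -
    define \<delta> where "\<delta> = Max (range (\<lambda>k. \<bar>x $ k - x' $ k\<bar>))"
    have le: "\<bar>x $ k - x' $ k\<bar> \<le> \<delta>" for k unfolding \<delta>_def by (rule Max_ge) auto
    have cst: "pseries 1 b (\<lambda>_ :: real ^ 'k. a)" if "\<bar>a\<bar> \<le> b" for a b :: real
      using pseries_mono[OF pseries_const[of 1 a] _ order_refl, of b] that by simp
    have "pseries 1 (\<delta> / 2) (\<lambda>_ :: real ^ 'k. N x $ k - N x' $ k)" for k
      by (rule contr) (use xs le in \<open>auto intro!: cst simp: closed_cube_def\<close>)
    from pseries_norm_le[OF this, of 0] have "\<bar>N x $ k - N x' $ k\<bar> \<le> \<delta> / 2" for k
      by (simp add: closed_cube_def)
    moreover have "x $ k + N x $ k = x' $ k + N x' $ k" for k using eq by (metis vector_add_component)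
    ultimately have "\<bar>x $ k - x' $ k\<bar> \<le> \<delta> / 2" for k by (smt (verit))
    then have "\<delta> \<le> \<delta> / 2" unfolding \<delta>_def by (subst Max_le_iff) auto
    then have "\<bar>x $ k - x' $ k\<bar> \<le> 0" for k using le[of k] by linarith
    then show ?thesis by (simp add: vec_eq_iff)
  qed
  have Nb: "\<bar>N x $ k\<bar> \<le> s / 4" if "x \<in> closed_cube s" for x k
    using pseries_norm_le[OF Ns that] by simp
  show thesis by (rule that[OF s \<phi>ps fixpt Nb uniq])
qed

text \<open>Along a line a power series becomes a power series in one variable, to which the library theorems
  on termwise differentiation apply. The reduction is a composition with a linear map from the
  one-dimensional space, where multi-indices are natural numbers.\<close>

lemma pseries_ray_C1:
  fixes g :: "real ^ 'k::finite \<Rightarrow> real"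
  assumes g: "pseries r C g"
  obtains e where "0 < e" "(\<lambda>t. g (t *\<^sub>R v)) C1_differentiable_on {-e<..<e}"
proof -
  define e where "e = r / (1 + norm v)"
  have r: "0 < r" using g by (rule pseries_pos)
  have e: "0 < e" using r unfolding e_def by (intro divide_pos_pos) (auto intro: add_pos_nonneg)
  have "e * (1 + norm v) = r" by (simp add: e_def add_nonneg_eq_0_iff)
  then have ev: "\<bar>v $ k\<bar> * e \<le> r" for k
    using mult_left_mono[of "\<bar>v $ k\<bar>" "1 + norm v" e] component_le_norm_cart[of v k] e
    by (simp add: mult.commute)
  have "pseries e C (\<lambda>x :: real ^ 1. g (x $ 1 *\<^sub>R v))"
  proof (rule pseries_compose[OF g])
    show "pseries e r (\<lambda>x :: real ^ 1. (x $ 1 *\<^sub>R v) $ k)" for k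
      using pseries_mono[OF pseries_cmult[OF pseries_coord[OF e, of "1::1"], of "v $ k"] e order_refl, of r] ev[of k]
      by (simp add: mult.commute)
  qed
  then obtain c where c: "expands e C c (\<lambda>x :: real ^ 1. g (x $ 1 *\<^sub>R v))" by (auto simp: pseries_def)
  define a where "a n = c (\<lambda>_. n)" for n
  have sums: "(\<lambda>n. a n * t ^ n) sums g (t *\<^sub>R v)" if "\<bar>t\<bar> < e" for t
  proof -
    have "((\<lambda>\<alpha>. mpow (vec t :: real ^ 1) \<alpha> *\<^sub>R c \<alpha>) has_sum g (t *\<^sub>R v)) UNIV"
    proof -
      have "(vec t :: real ^ 1) \<in> closed_cube e" using that by (simp add: closed_cube_def)
      then show ?thesis using c unfolding expands_def by force
    qed
    moreover have "bij_betw (\<lambda>n (_::1). n :: nat) UNIV UNIV"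
      by (rule bij_betwI[where g = "\<lambda>\<alpha>. \<alpha> 1"]) (auto simp: fun_eq_iff)
    ultimately have "((\<lambda>n. mpow (vec t :: real ^ 1) (\<lambda>_. n) *\<^sub>R c (\<lambda>_. n)) has_sum g (t *\<^sub>R v)) UNIV"
      using has_sum_reindex_bij_betw[of "\<lambda>n (_::1). n :: nat" UNIV UNIV
          "\<lambda>\<alpha>. mpow (vec t :: real ^ 1) \<alpha> *\<^sub>R c \<alpha>"] by simp
    then have "((\<lambda>n. a n * t ^ n) has_sum g (t *\<^sub>R v)) UNIV"
      by (simp add: mpow_def a_def mult.commute)
    then show ?thesis by (rule has_sum_imp_sums)
  qed
  have summ: "summable (\<lambda>n. a n * z ^ n)" if "norm z < e" for z
    using sums_summable[OF sums[of z]] that by simp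
  have dsumm: "summable (\<lambda>n. diffs a n * z ^ n)" if "norm z < e" for z
    by (rule termdiff_converges[OF that summ])
  have "(\<lambda>t. g (t *\<^sub>R v)) C1_differentiable_on {-e<..<e}"
    unfolding C1_differentiable_on_def
  proof (intro exI[of _ "\<lambda>z. suminf (\<lambda>n. diffs a n * z ^ n)"] conjI ballI)
    fix z assume z: "z \<in> {-e<..<e}"
    then have nz: "norm z < e" by auto
    have "((\<lambda>z. suminf (\<lambda>n. a n * z ^ n)) has_field_derivative (suminf (\<lambda>n. diffs a n * z ^ n))) (at z)"
      by (rule termdiffs_strong'[OF summ nz])
    then have "((\<lambda>t. g (t *\<^sub>R v)) has_field_derivative (suminf (\<lambda>n. diffs a n * z ^ n))) (at z)"
      by (rule has_field_derivative_transform_within_open[of _ _ _ "{-e<..<e}"])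
         (use z sums in \<open>auto simp: sums_iff abs_less_iff\<close>)
    then show "((\<lambda>t. g (t *\<^sub>R v)) has_vector_derivative (suminf (\<lambda>n. diffs a n * z ^ n))) (at z)"
      by (simp add: has_real_derivative_iff_has_vector_derivative)
  next
    show "continuous_on {-e<..<e} (\<lambda>z. suminf (\<lambda>n. diffs a n * z ^ n))"
    proof (intro continuous_at_imp_continuous_on ballI)
      fix z assume "z \<in> {-e<..<e}"
      then have "\<bar>z\<bar> < e" by auto
      then obtain K where K: "\<bar>z\<bar> < K" "K < e" using dense by blast
      show "isCont (\<lambda>z. suminf (\<lambda>n. diffs a n * z ^ n)) z"
        by (rule isCont_powser[where K = K]) (use dsumm[of K] K in auto)
    qed
  qed
  then show thesis using that e by blast
qed

lemma pseries_vec_ray_C1: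
  fixes g :: "real ^ 'k::finite \<Rightarrow> real ^ 'm::finite"
  assumes g: "\<And>i. pseries r C (\<lambda>x. g x $ i)"
  obtains e where "0 < e" "(\<lambda>t. g (t *\<^sub>R v)) C1_differentiable_on {-e<..<e}"
proof -
  have "\<forall>i. \<exists>e>0. (\<lambda>t. g (t *\<^sub>R v) $ i) C1_differentiable_on {-e<..<e}"
    using pseries_ray_C1[OF g] by metis
  then obtain e where e: "\<And>i. 0 < e i" "\<And>i. (\<lambda>t. g (t *\<^sub>R v) $ i) C1_differentiable_on {-e i<..<e i}"
    by metis
  define m where "m = Min (range e)"
  have m: "0 < m" unfolding m_def using e(1) by (subst Min_gr_iff) auto
  have mle: "m \<le> e i" for i unfolding m_def by (rule Min_le) auto
  have C1: "(\<lambda>t. g (t *\<^sub>R v) $ i) C1_differentiable_on {-m<..<m}" for i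
    by (rule C1_differentiable_on_subset[OF e(2)[of i]]) (use mle[of i] in auto)
  have "(\<lambda>t. \<Sum>i\<in>A. g (t *\<^sub>R v) $ i *\<^sub>R (axis i 1 :: real ^ 'm)) C1_differentiable_on {-m<..<m}" if "finite A" for A
    using that by induction (auto intro!: C1_differentiable_on_add C1_differentiable_on_scaleR C1)
  from this[of UNIV] have "(\<lambda>t. g (t *\<^sub>R v)) C1_differentiable_on {-m<..<m}"
    by (simp add: scalar_mult_eq_scaleR[symmetric] basis_expansion)
  then show thesis using that m by blast
qed

section \<open>Real analytic functions\<close>

definition analytic_at :: "(real ^ 'k::finite \<Rightarrow> 'a::banach) \<Rightarrow> real ^ 'k \<Rightarrow> bool" where
  "analytic_at g p \<longleftrightarrow> (\<exists>r C. pseries r C (\<lambda>x. g (p + x)))"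

lemma analytic_atI: "pseries r C (\<lambda>x. g (p + x)) \<Longrightarrow> analytic_at g p"
  by (auto simp: analytic_at_def)

lemma real_analytic_onI:
  fixes g :: "real ^ 'k::finite \<Rightarrow> real ^ 'm::finite"
  assumes "\<And>p. p \<in> U \<Longrightarrow> analytic_at g p"
  shows "real_analytic_on g U"
  unfolding real_analytic_on_def
proof
  fix p assume p: "p \<in> U"
  obtain r C c where c: "expands r C c (\<lambda>x. g (p + x))"
    using assms[OF p] unfolding analytic_at_def pseries_def by blast
  have "((\<lambda>\<alpha>. (\<Prod>k\<in>UNIV. (x $ k - p $ k) ^ \<alpha> k) *\<^sub>R c \<alpha>) has_sum g x) UNIV" if "x \<in> ball p r" for x
  proof -
    have "norm (x - p) < r" using that by (simp add: dist_norm norm_minus_commute)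
    then have "x - p \<in> closed_cube r" using norm_in_cube closed_cube_mono less_imp_le by blast
    then have "((\<lambda>\<alpha>. mpow (x - p) \<alpha> *\<^sub>R c \<alpha>) has_sum g (p + (x - p))) UNIV"
      using c unfolding expands_def by blast
    then show ?thesis by (simp add: mpow_def)
  qed
  moreover have "0 < r" using c by (simp add: expands_def)
  ultimately show "\<exists>r>0. \<exists>c. \<forall>x\<in>ball p r.
        ((\<lambda>\<alpha>. (\<Prod>k\<in>UNIV. (x $ k - p $ k) ^ \<alpha> k) *\<^sub>R c \<alpha>) has_sum g x) UNIV"
    by blast
qed

lemma pseries_analytic_at:
  assumes g: "pseries R C g" and p: "p \<in> open_cube R"
  shows "analytic_at g p"
proof -
  define r where "r = Min (range (\<lambda>k. R - \<bar>p $ k\<bar>))"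
  have r: "0 < r" unfolding r_def using p by (subst Min_gr_iff) (auto simp: open_cube_def)
  have "r \<le> R - \<bar>p $ k\<bar>" for k unfolding r_def by (rule Min_le) auto
  then have "\<bar>p $ k\<bar> + r \<le> R" for k by (simp add: algebra_simps)
  then show ?thesis using pseries_translate[OF g _ r] analytic_atI by blast
qed

lemma analytic_at_shift: "analytic_at (\<lambda>x. g (x - a)) p \<longleftrightarrow> analytic_at g (p - a)"
  by (simp add: analytic_at_def algebra_simps)

lemma analytic_at_vec:
  fixes g :: "real ^ 'k::finite \<Rightarrow> real ^ 'm::finite"
  assumes "\<And>i. analytic_at (\<lambda>x. g x $ i) p"
  shows "analytic_at g p"
proof -
  obtain r C where rC: "\<And>i. pseries (r i) (C i) (\<lambda>x. g (p + x) $ i)"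
    using assms unfolding analytic_at_def by metis
  define s where "s = Min (range r)"
  have "0 < r i" for i using rC pseries_pos by blast
  then have s: "0 < s" unfolding s_def by (subst Min_gr_iff) auto
  have sr: "s \<le> r i" for i unfolding s_def by (rule Min_le) auto
  have CM: "C i \<le> Max (range C)" for i by (rule Max_ge) auto
  have "pseries s (real CARD('m) * Max (range C)) (\<lambda>x. g (p + x))"
    by (intro pseries_vec s pseries_mono[OF rC _ sr CM])
  then show ?thesis by (rule analytic_atI)
qed

lemma analytic_at_bounded_linear:
  assumes "bounded_linear T" "analytic_at g p"
  shows "analytic_at (\<lambda>x. T (g x)) p"
proof -
  obtain K where K: "0 \<le> K" "\<And>y. norm (T y) \<le> K * norm y"
    using bounded_linear.nonneg_bounded[OF assms(1)] by (auto simp: mult.commute)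
  then show ?thesis
    using assms(2) pseries_bounded_linear[OF _ assms(1) K] unfolding analytic_at_def by blast
qed

lemma analytic_at_const: "analytic_at (\<lambda>_. a) p"
  using pseries_const[of 1 a] by (auto simp: analytic_at_def)

lemma analytic_at_add:
  assumes "analytic_at g p" "analytic_at h p"
  shows "analytic_at (\<lambda>x. g x + h x) p"
proof -
  obtain r C s D where *: "pseries r C (\<lambda>x. g (p + x))" "pseries s D (\<lambda>x. h (p + x))"
    using assms by (auto simp: analytic_at_def)
  have "0 < min r s" using *[THEN pseries_pos] by simp
  then show ?thesis
    using pseries_add[OF pseries_mono[OF *(1)] pseries_mono[OF *(2)], of "min r s" C D]
    by (auto simp: analytic_at_def)
qed

lemma analytic_at_mult:
  fixes g h :: "real ^ 'k::finite \<Rightarrow> 'a::{real_normed_algebra, banach}"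
  assumes "analytic_at g p" "analytic_at h p"
  shows "analytic_at (\<lambda>x. g x * h x) p"
proof -
  obtain r C s D where *: "pseries r C (\<lambda>x. g (p + x))" "pseries s D (\<lambda>x. h (p + x))"
    using assms by (auto simp: analytic_at_def)
  have "0 < min r s" using *[THEN pseries_pos] by simp
  then show ?thesis
    using pseries_mult[OF pseries_mono[OF *(1)] pseries_mono[OF *(2)], of "min r s" C D]
    by (auto simp: analytic_at_def)
qed

lemma analytic_at_linear:
  fixes T :: "real ^ 'k::finite \<Rightarrow> 'a::banach"
  assumes "bounded_linear T"
  shows "analytic_at T p"
proof -
  have "pseries 1 1 (\<lambda>x :: real ^ 'k. x $ k)" for k by (rule pseries_coord) simp
  then have "pseries 1 (real CARD('k) * 1) (\<lambda>x :: real ^ 'k. x)" by (intro pseries_vec) auto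
  then have "analytic_at (\<lambda>x. x) (0 :: real ^ 'k)" by (auto simp: analytic_at_def)
  then have "analytic_at (\<lambda>x. p + x) 0" by (intro analytic_at_add analytic_at_const)
  then have "analytic_at (\<lambda>x. x) p" by (simp add: analytic_at_def)
  then show ?thesis by (rule analytic_at_bounded_linear[OF assms])
qed

lemma analytic_at_sum:
  "(\<And>j. j \<in> J \<Longrightarrow> analytic_at (g j) p) \<Longrightarrow> analytic_at (\<lambda>x. \<Sum>j\<in>J. g j x) p"
  by (induction J rule: infinite_finite_induct) (auto intro: analytic_at_add analytic_at_const)

lemma analytic_at_prod:
  fixes g :: "'j \<Rightarrow> real ^ 'k::finite \<Rightarrow> 'a::{real_normed_field, banach}"
  shows "(\<And>j. j \<in> J \<Longrightarrow> analytic_at (g j) p) \<Longrightarrow> analytic_at (\<lambda>x. \<Prod>j\<in>J. g j x) p"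
  by (induction J rule: infinite_finite_induct) (auto intro: analytic_at_mult analytic_at_const)

lemma analytic_at_power:
  fixes g :: "real ^ 'k::finite \<Rightarrow> 'a::{real_normed_field, banach}"
  shows "analytic_at g p \<Longrightarrow> analytic_at (\<lambda>x. g x ^ n) p"
  using analytic_at_prod[of "{..<n}" "\<lambda>_. g"] by simp

text \<open>With \<open>h = 1 - g / g(p)\<close>, \<open>1 / g = (1 / g(p)) \<Sum>\<^sub>n h\<^sup>n\<close>. As \<open>h\<close> vanishes at \<open>p\<close>, its norm is at
  most \<open>1/2\<close> on a small cube.\<close>

lemma analytic_at_inverse:
  fixes g :: "real ^ 'k::finite \<Rightarrow> 'a::{real_normed_field, banach}"
  assumes g: "analytic_at g p" and nz: "g p \<noteq> 0"
  shows "analytic_at (\<lambda>x. inverse (g x)) p"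
proof -
  have "analytic_at (\<lambda>x. 1 + - (inverse (g p) * g x)) p"
    by (intro analytic_at_add analytic_at_mult analytic_at_const
        analytic_at_bounded_linear[OF bounded_linear_minus[OF bounded_linear_ident]] g)
  then obtain r C c where c: "expands r C c (\<lambda>x. 1 + - (inverse (g p) * g (p + x)))"
    by (auto simp: analytic_at_def pseries_def)
  define h where "h x = 1 + - (inverse (g p) * g (p + x))" for x
  have c: "expands r C c h" using c unfolding h_def[abs_def] .
  have r: "0 < r" and C: "0 \<le> C"
    using expands_pseries[OF c] pseries_pos pseries_nonneg by blast+
  have "c (\<lambda>_. 0) = 0" using expands_at_0[OF c] nz by (simp add: h_def)
  moreover have "\<alpha> = (\<lambda>_. 0)" if "mdeg \<alpha> < 1" for \<alpha> :: "'k \<Rightarrow> nat"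
    using that by (auto simp: mdeg_def fun_eq_iff)
  ultimately have van: "c \<alpha> = 0" if "mdeg \<alpha> < 1" for \<alpha> using that by metis
  define t where "t = 1 / (2 * (C + 1))"
  have t: "0 < t" "t \<le> 1" "t ^ 1 * C \<le> 1 / 2" using C by (auto simp: t_def field_simps)
  have h: "pseries (t * r) (1 / 2) h"
    using pseries_mono[OF expands_pseries[OF expands_shrink[OF c van t(1,2)]] _ order_refl t(3)] t r
    by simp
  have tr: "0 < t * r" using t r by simp
  have geo: "(\<lambda>n. (1/2) ^ n) sums (2::real)" using geometric_sums[of "1/2::real"] by simp
  have "pseries (t * r) 2 (\<lambda>x. inverse (1 - h x))"
  proof (rule pseries_infsum[OF tr, where J = UNIV])
    show "pseries (t * r) ((1/2) ^ n) (\<lambda>x. h x ^ n)" for n by (rule pseries_power[OF h])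
    show "sums_below (\<lambda>n. (1/2) ^ n) UNIV 2"
    proof (rule sums_belowI)
      fix F :: "nat set" assume "finite F"
      then show "(\<Sum>n\<in>F. (1/2) ^ n) \<le> (2::real)"
        using sum_le_suminf[OF sums_summable[OF geo], of F] sums_unique[OF geo] by simp
    qed
    show "((\<lambda>n. h x ^ n) has_sum inverse (1 - h x)) UNIV" if "x \<in> closed_cube (t * r)" for x
    proof (rule norm_summable_imp_has_sum)
      have "norm (h x) \<le> 1 / 2" by (rule pseries_norm_le[OF h that])
      then have "norm (h x) < 1" by simp
      then show "summable (\<lambda>n. norm (h x ^ n))" "(\<lambda>n. h x ^ n) sums inverse (1 - h x)"
        using geometric_sums[of "h x"] by (simp_all add: norm_power summable_geometric divide_inverse)
    qed
  qed
  from pseries_cmult[OF this, of "inverse (g p)"] show ?thesis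
    using nz by (intro analytic_atI) (simp add: h_def inverse_mult_distrib mult.assoc[symmetric])
qed

lemma analytic_at_cong:
  assumes g: "analytic_at g p" and U: "open U" "p \<in> U" and eq: "\<And>x. x \<in> U \<Longrightarrow> g x = h x"
  shows "analytic_at h p"
proof -
  obtain r C where rC: "pseries r C (\<lambda>x. g (p + x))" using g by (auto simp: analytic_at_def)
  obtain e where e: "0 < e" "ball p e \<subseteq> U" using U open_contains_ball by blast
  define s where "s = min r (e / (2 * real CARD('a)))"
  have s: "0 < s" "s \<le> r" using pseries_pos[OF rC] e by (auto simp: s_def)
  have "p + x \<in> U" if "x \<in> closed_cube s" for x
  proof -
    have "norm x \<le> (\<Sum>k\<in>UNIV. \<bar>x $ k\<bar>)" by (rule norm_le_l1_cart)
    also have "\<dots> \<le> (\<Sum>k\<in>(UNIV :: 'a set). s)" by (rule sum_mono) (use that in \<open>auto simp: closed_cube_def\<close>)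
    also have "\<dots> = real CARD('a) * s" by simp
    also have "\<dots> \<le> real CARD('a) * (e / (2 * real CARD('a)))"
      by (rule mult_left_mono) (auto simp: s_def)
    also have "\<dots> < e" using e by simp
    finally show ?thesis using e(2) by (auto simp: dist_norm)
  qed
  then have "pseries s C (\<lambda>x. h (p + x))"
    by (intro pseries_cong[OF pseries_mono[OF rC s order_refl]]) (auto simp: eq)
  then show ?thesis by (rule analytic_atI)
qed

lemma analytic_at_imp_differentiable:
  assumes "analytic_at g p"
  shows "g differentiable at p"
proof -
  obtain r C c where "expands r C c (\<lambda>x. g (p + x))"
    using assms by (auto simp: analytic_at_def pseries_def)
  from expands_has_derivative[OF this] obtain D where "((\<lambda>x. g (p + x)) has_derivative D) (at 0)" by blast
  moreover have "((\<lambda>x. x - p) has_derivative (\<lambda>h. h)) (at p)"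
    by (auto intro!: derivative_eq_intros)
  ultimately have "((\<lambda>x. g (p + (x - p))) has_derivative (\<lambda>h. D h)) (at p)"
    using has_derivative_compose[of "\<lambda>x. x - p" "\<lambda>h. h" p UNIV "\<lambda>x. g (p + x)" D] by simp
  then show ?thesis by (auto simp: differentiable_def)
qed

section \<open>The regular value theorem\<close>

text \<open>The chart \<open>\<psi>\<close> satisfies \<open>D \<circ> \<psi> = G\<close> and therefore takes the level set to the kernel of \<open>D\<close>. The
  tangent space is contained in the kernel by the chain rule; conversely the analytic inverse \<open>\<phi>\<close>
  of the chart takes the segment \<open>t h\<close>, for \<open>h\<close> in the kernel, to a curve in the level set, with
  velocity \<open>h\<close> because the derivative of \<open>\<phi>\<close> at \<open>0\<close> is the identity.\<close>

theorem analytic_level_set: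
  fixes G :: "real ^ 'k::finite \<Rightarrow> real ^ 'm::finite"
  assumes an: "analytic_at G p" and D: "(G has_derivative D) (at p)" and surj: "surj D"
    and U0: "open U0" "p \<in> U0" and MU0: "M \<inter> U0 = {x \<in> U0. G x = 0}" and Gp: "G p = 0"
  shows "analytic_submanifold_near M (dim {h. D h = 0}) p"
    and "tangent_space M p = {h. D h = 0}"
proof -
  have lin: "linear D" using D has_derivative_linear by blast
  obtain A where A: "linear A" "D \<circ> A = id" using linear_surjective_right_inverse[OF lin surj] by blast
  have blA: "bounded_linear A" and blD: "bounded_linear D"
    using A(1) lin by (simp_all add: linear_conv_bounded_linear)
  define N where "N x = A (G (p + x) - D x)" for x
  have "analytic_at (\<lambda>x. G (p + x)) 0" using an by (simp add: analytic_at_def)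
  then have "analytic_at (\<lambda>x. G (p + x) + - D x) 0"
    by (rule analytic_at_add) (rule analytic_at_linear[OF bounded_linear_minus[OF blD]])
  from analytic_at_bounded_linear[OF blA this]
  obtain R C where RC: "pseries R C N" by (auto simp: analytic_at_def N_def[abs_def])
  have NkC: "pseries R C (\<lambda>x. N x $ k)" for k
    using pseries_bounded_linear[OF RC bounded_linear_vec_nth[of k], of 1] by (simp add: component_le_norm_cart)
  have N0: "N 0 = 0" using Gp linear_0[OF A(1)] linear_0[OF lin] by (simp add: N_def)
  have dsh: "((\<lambda>x. p + x) has_derivative (\<lambda>h. h)) (at 0)"
    by (auto intro!: derivative_eq_intros)
  have dG0: "((\<lambda>x. G (p + x)) has_derivative D) (at 0)"
    using has_derivative_compose[OF dsh, of G D] D by simp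
  have "((\<lambda>x. G (p + x) - D x) has_derivative (\<lambda>h. D h - D h)) (at 0)"
    by (intro has_derivative_diff dG0 bounded_linear_imp_has_derivative blD)
  from bounded_linear.has_derivative[OF blA this]
  have dN: "(N has_derivative (\<lambda>_. 0)) (at 0)"
    unfolding N_def using linear_0[OF A(1)] by simp
  obtain s \<phi> where s: "0 < s" "s \<le> R / 2"
    and \<phi>ps: "\<And>k. pseries (s / 2) (2 * s) (\<lambda>y. \<phi> y $ k)"
    and \<phi>fix: "\<And>y. y \<in> closed_cube (s / 2) \<Longrightarrow> \<phi> y \<in> closed_cube s \<and> \<phi> y + N (\<phi> y) = y"
    and Nb: "\<And>x k. x \<in> closed_cube s \<Longrightarrow> \<bar>N x $ k\<bar> \<le> s / 4"
    and uniq: "\<And>x x'. x \<in> closed_cube s \<Longrightarrow> x' \<in> closed_cube s \<Longrightarrow> x + N x = x' + N x' \<Longrightarrow> x = x'"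
    by (rule near_identity_inverse[OF NkC N0 dN]) (rule that)
  have \<phi>s: "\<phi> y \<in> open_cube s" if "y \<in> open_cube (s / 2)" for y
    unfolding open_cube_def
  proof safe
    fix k
    have f: "\<phi> y \<in> closed_cube s" "\<phi> y + N (\<phi> y) = y" using \<phi>fix open_cube_imp_closed_cube[OF that] by auto
    then have "\<phi> y $ k = y $ k - N (\<phi> y) $ k" by (metis add_diff_cancel vector_add_component)
    moreover have "\<bar>y $ k\<bar> < s / 2" using that by (simp add: open_cube_def)
    ultimately show "\<bar>\<phi> y $ k\<bar> < s" using Nb[OF f(1), of k] s by linarith
  qed
  have sR: "x \<in> open_cube R" if "x \<in> open_cube s" for x
  proof -
    have "s < R" using s by linarith
    then show ?thesis using that by (auto simp: open_cube_def intro: less_trans)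
  qed
  \<comment> \<open>The chart in coordinates centred at \<open>p\<close>; the shift back is made in \<open>\<psi>\<close> and \<open>\<phi>'\<close> below.\<close>
  define \<psi>0 where "\<psi>0 x = x + N x" for x
  have D\<psi>: "D (\<psi>0 x) = G (p + x)" for x
  proof -
    have "D (A y) = y" for y using A(2) by (metis comp_apply id_apply)
    then show ?thesis by (simp add: \<psi>0_def N_def linear_add[OF lin])
  qed
  have \<psi>0an: "analytic_at \<psi>0 x" if "x \<in> open_cube s" for x
    unfolding \<psi>0_def
    by (intro analytic_at_add analytic_at_linear bounded_linear_ident pseries_analytic_at[OF RC] sR that)
  have \<phi>an: "analytic_at \<phi> y" if "y \<in> open_cube (s / 2)" for y
    by (rule analytic_at_vec, rule pseries_analytic_at[OF \<phi>ps that])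
  have cont: "isCont g x" if "analytic_at g x" for g :: "real ^ 'k \<Rightarrow> real ^ 'k" and x
    by (rule differentiable_imp_continuous_within[OF analytic_at_imp_differentiable[OF that]])
  define \<psi> where "\<psi> X = \<psi>0 (X - p)" for X
  define \<phi>' where "\<phi>' y = p + \<phi> y" for y
  have \<psi>an: "analytic_at \<psi> X" if "X - p \<in> open_cube s" for X
    using \<psi>0an[OF that] unfolding \<psi>_def by (simp add: analytic_at_shift)
  have \<phi>'an: "analytic_at \<phi>' y" if "y \<in> open_cube (s / 2)" for y
    unfolding \<phi>'_def by (intro analytic_at_add analytic_at_const \<phi>an that)
  define B where "B = (\<lambda>X. X - p) -` open_cube s \<inter> U0"
  have oB: "open B" unfolding B_def
    by (intro open_Int open_vimage open_open_cube U0 continuous_intros)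
  \<comment> \<open>Both sides are cut down so that \<open>\<psi>\<close> and \<open>\<phi>'\<close> are mutually inverse and \<open>U\<close> stays inside \<open>U0\<close>,
    where \<open>M\<close> is the zero set of \<open>G\<close>.\<close>
  define U where "U = B \<inter> \<psi> -` open_cube (s / 2)"
  define W where "W = open_cube (s / 2) \<inter> \<phi>' -` U0"
  have cB: "continuous_on B \<psi>"
    by (intro continuous_at_imp_continuous_on ballI cont \<psi>an) (auto simp: B_def)
  have cW: "continuous_on (open_cube (s / 2)) \<phi>'"
    by (intro continuous_at_imp_continuous_on ballI cont \<phi>'an)
  have oU: "open U" unfolding U_def by (rule continuous_open_preimage[OF cB oB open_open_cube])
  have oW: "open W" unfolding W_def by (rule continuous_open_preimage[OF cW open_open_cube U0(1)])
  have s2: "0 < s / 2" using s by simp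
  have \<psi>p: "\<psi> p = 0" by (simp add: \<psi>_def \<psi>0_def N0)
  have pU: "p \<in> U" using U0 s by (simp add: U_def B_def \<psi>p open_cube_def)
  have inv1: "\<phi>' (\<psi> X) = X" and \<psi>W: "\<psi> X \<in> W" if X: "X \<in> U" for X
  proof -
    have c: "\<psi> X \<in> open_cube (s / 2)" "X - p \<in> open_cube s" "X \<in> U0" using X by (auto simp: U_def B_def)
    have "\<phi> (\<psi> X) = X - p"
      by (rule uniq)
         (use \<phi>fix[OF open_cube_imp_closed_cube[OF c(1)]] open_cube_imp_closed_cube[OF c(2)] in \<open>auto simp: \<psi>_def \<psi>0_def\<close>)
    then show st: "\<phi>' (\<psi> X) = X" by (simp add: \<phi>'_def)
    show "\<psi> X \<in> W" using c st by (simp add: W_def)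
  qed
  have inv2: "\<psi> (\<phi>' y) = y" and \<phi>'U: "\<phi>' y \<in> U" if y: "y \<in> W" for y
  proof -
    have c: "y \<in> open_cube (s / 2)" "\<phi>' y \<in> U0" using y by (auto simp: W_def)
    show st: "\<psi> (\<phi>' y) = y" using \<phi>fix[OF open_cube_imp_closed_cube[OF c(1)]] by (simp add: \<psi>_def \<psi>0_def \<phi>'_def)
    show "\<phi>' y \<in> U" using c st \<phi>s[OF c(1)] by (simp add: U_def B_def) (simp add: \<phi>'_def)
  qed
  define L where "L = {h. D h = 0}"
  have subL: "subspace L" unfolding L_def by (rule linear_subspace_kernel[OF lin])
  have M_iff: "X \<in> M \<longleftrightarrow> \<psi> X \<in> L" if "X \<in> U" for X
  proof -
    have "X \<in> U0" using that by (simp add: U_def B_def)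
    then show ?thesis using MU0 D\<psi>[of "X - p"] by (auto simp: L_def \<psi>_def)
  qed
  have img: "\<psi> ` (M \<inter> U) = W \<inter> L"
  proof (intro equalityI subsetI)
    fix y assume "y \<in> W \<inter> L"
    then show "y \<in> \<psi> ` (M \<inter> U)"
      using inv2[of y] \<phi>'U[of y] M_iff[of "\<phi>' y"] by (intro image_eqI[of _ _ "\<phi>' y"]) auto
  qed (use M_iff \<psi>W in auto)
  have pM: "p \<in> M" using MU0 U0 Gp by blast
  have hom: "homeomorphism U W \<psi> \<phi>'"
  proof (rule homeomorphismI)
    show "continuous_on U \<psi>" by (rule continuous_on_subset[OF cB]) (auto simp: U_def)
    show "continuous_on W \<phi>'" by (rule continuous_on_subset[OF cW]) (auto simp: W_def)
  qed (use inv1 inv2 \<psi>W \<phi>'U in auto)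
  have "real_analytic_on \<psi> U" "real_analytic_on \<phi>' W"
    by (rule real_analytic_onI, rule \<psi>an \<phi>'an, simp add: U_def B_def W_def)+
  then show "analytic_submanifold_near M (dim {h. D h = 0}) p"
    unfolding analytic_submanifold_near_def L_def[symmetric]
    using pM oU pU oW hom subL img by blast

  show "tangent_space M p = {h. D h = 0}"
  proof (intro equalityI subsetI)
    fix v assume "v \<in> tangent_space M p"
    then obtain \<gamma> e where v: "v = vector_derivative \<gamma> (at 0)" and e: "0 < e"
      and C1: "\<gamma> C1_differentiable_on {-e<..<e}" and in_M: "\<gamma> ` {-e<..<e} \<subseteq> M" and \<gamma>0: "\<gamma> 0 = p"
      unfolding tangent_space_def by blast
    have "\<gamma> differentiable at 0" using C1 e by (auto simp: C1_differentiable_on_eq)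
    then have hv: "(\<gamma> has_vector_derivative v) (at 0)" by (simp add: v vector_derivative_works)
    then have hd: "(\<gamma> has_derivative (\<lambda>t. t *\<^sub>R v)) (at 0)" by (simp add: has_vector_derivative_def)
    have "(G has_derivative D) (at (\<gamma> 0))" using D \<gamma>0 by simp
    from has_derivative_compose[OF hd this]
    have 1: "((\<lambda>t. G (\<gamma> t)) has_derivative (\<lambda>t. D (t *\<^sub>R v))) (at 0)" .
    have "isCont \<gamma> 0" using hv has_vector_derivative_continuous by blast
    then have "\<forall>\<^sub>F t in at 0. \<gamma> t \<in> U0"
      using U0 \<gamma>0 unfolding isCont_def by (metis topological_tendstoD)
    moreover have "\<forall>\<^sub>F t in at 0. t \<in> {-e<..<e}"
      by (rule eventually_at_in_open') (use e in auto)
    ultimately have ev: "\<forall>\<^sub>F t in at 0. 0 = G (\<gamma> t)"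
      by eventually_elim (use in_M MU0 in \<open>auto simp: image_subset_iff\<close>)
    have "((\<lambda>t. G (\<gamma> t)) has_derivative (\<lambda>_. 0)) (at 0)"
      by (rule has_derivative_transform_eventually[OF has_derivative_const ev]) (auto simp: \<gamma>0 Gp)
    then have "(\<lambda>t. D (t *\<^sub>R v)) = (\<lambda>_. 0)" using 1 has_derivative_unique by blast
    then have "D (1 *\<^sub>R v) = 0" by metis
    then show "v \<in> {h. D h = 0}" by simp
  next
    fix h assume h: "h \<in> {h. D h = 0}"
    obtain e1 where e1: "0 < e1" "(\<lambda>t. \<phi> (t *\<^sub>R h)) C1_differentiable_on {-e1<..<e1}"
      by (rule pseries_vec_ray_C1[OF \<phi>ps])
    have W0: "0 \<in> W" using \<psi>W[OF pU] \<psi>p by simp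
    have ow: "open ((\<lambda>t. t *\<^sub>R h) -` W)" by (intro open_vimage oW continuous_intros)
    have "(0::real) \<in> (\<lambda>t. t *\<^sub>R h) -` W" using W0 by simp
    then obtain e2 where e2: "0 < e2" "ball 0 e2 \<subseteq> (\<lambda>t. t *\<^sub>R h) -` W"
      using ow open_contains_ball by blast
    define e where "e = min e1 e2"
    define \<gamma> where "\<gamma> t = \<phi>' (t *\<^sub>R h)" for t
    have C1: "\<gamma> C1_differentiable_on {-e<..<e}"
      unfolding \<gamma>_def \<phi>'_def
      by (intro C1_differentiable_on_add C1_differentiable_on_const C1_differentiable_on_subset[OF e1(2)])
         (auto simp: e_def)
    have in_M: "\<gamma> t \<in> M" if "t \<in> {-e<..<e}" for t
    proof -
      have "t \<in> ball 0 e2" using that by (auto simp: e_def)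
      then have tW: "t *\<^sub>R h \<in> W" using e2 by auto
      have "D (t *\<^sub>R h) = 0" using h by (simp add: linear_cmul[OF lin])
      then show ?thesis using inv2[OF tW] M_iff[OF \<phi>'U[OF tW]] by (simp add: \<gamma>_def L_def)
    qed
    have \<gamma>0: "\<gamma> 0 = p" using inv1[OF pU] by (simp add: \<gamma>_def \<psi>p)
    then have \<phi>0: "\<phi> 0 = 0" by (simp add: \<gamma>_def \<phi>'_def)
    have "(0 :: real ^ 'k) \<in> open_cube (s / 2)" using W0 by (simp add: W_def)
    then obtain T where T: "(\<phi> has_derivative T) (at 0)"
      using analytic_at_imp_differentiable[OF \<phi>an] by (auto simp: differentiable_def)
    have d\<psi>: "(\<psi>0 has_derivative (\<lambda>h. h + 0)) (at (\<phi> 0))"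
      unfolding \<psi>0_def \<phi>0 by (intro has_derivative_add has_derivative_ident dN)
    have c1: "((\<lambda>y. \<psi>0 (\<phi> y)) has_derivative (\<lambda>h. T h + 0)) (at 0)"
      by (rule has_derivative_compose[OF T d\<psi>])
    have "((\<lambda>y. \<psi>0 (\<phi> y)) has_derivative (\<lambda>h. h)) (at 0)"
    proof (rule has_derivative_transform_within_open[OF has_derivative_ident oW W0])
      show "y = \<psi>0 (\<phi> y)" if "y \<in> W" for y using inv2[OF that] by (simp add: \<psi>_def \<phi>'_def)
    qed
    then have "(\<lambda>h. T h + 0) = (\<lambda>h. h)" using c1 has_derivative_unique by blast
    then have "T = (\<lambda>h. h)" by simp
    then have "(\<phi> has_derivative (\<lambda>h. h)) (at (0 *\<^sub>R h))" using T by simp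
    moreover have "((\<lambda>t. t *\<^sub>R h) has_derivative (\<lambda>t. t *\<^sub>R h)) (at 0)"
      by (auto intro!: derivative_eq_intros)
    ultimately have "((\<lambda>t. \<phi> (t *\<^sub>R h)) has_derivative (\<lambda>t. t *\<^sub>R h)) (at 0)"
      using has_derivative_compose[of "\<lambda>t. t *\<^sub>R h" "\<lambda>t. t *\<^sub>R h" 0 UNIV \<phi> "\<lambda>h. h"] by simp
    then have "(\<gamma> has_derivative (\<lambda>t. t *\<^sub>R h)) (at 0)"
      unfolding \<gamma>_def \<phi>'_def by (auto intro!: derivative_eq_intros)
    then have "vector_derivative \<gamma> (at 0) = h"
      by (intro vector_derivative_at) (simp add: has_vector_derivative_def)
    moreover have "0 < e" using e1 e2 by (simp add: e_def)
    ultimately show "h \<in> tangent_space M p"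
      unfolding tangent_space_def using C1 in_M \<gamma>0 by (auto intro!: exI[of _ \<gamma>] exI[of _ e])
  qed
qed

section \<open>Rank and minors\<close>

text \<open>Rank-nullity on a subspace: \<open>f\<close> is injective on the orthogonal complement of its kernel in \<open>S\<close>, and
  the complement has the same image as \<open>S\<close>.\<close>

lemma dim_linear_image:
  fixes f :: "'a::euclidean_space \<Rightarrow> 'b::euclidean_space"
  assumes lin: "linear f" and S: "subspace S"
  shows "dim (f ` S) + dim {x \<in> S. f x = 0} = dim S"
proof -
  define K where "K = {x \<in> S. f x = 0}"
  define C where "C = {y \<in> S. \<forall>x\<in>K. orthogonal x y}"
  have "K = S \<inter> {x. f x = 0}" by (auto simp: K_def)
  then have K: "subspace K" by (simp add: subspace_inter S linear_subspace_kernel[OF lin])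
  have C: "subspace C"
    using S unfolding C_def subspace_def orthogonal_def by (auto simp: inner_add_right)
  have "inj_on f (span C)"
  proof -
    have "x = y" if "x \<in> C" "y \<in> C" "f x = f y" for x y
    proof -
      have "x - y \<in> C" using C that by (simp add: subspace_diff)
      moreover have "f (x - y) = 0" using that by (simp add: linear_diff[OF lin])
      ultimately have "orthogonal (x - y) (x - y)" by (auto simp: C_def K_def)
      then show ?thesis by (simp add: orthogonal_def)
    qed
    then show ?thesis using C by (simp add: span_eq_iff[THEN iffD2] inj_on_def)
  qed
  then have "dim (f ` C) = dim C" by (rule dim_image_eq[OF lin])
  moreover have "f ` C = f ` S"
  proof (intro equalityI subsetI)
    fix w assume "w \<in> f ` S"
    then obtain x where x: "x \<in> S" "w = f x" by blast
    obtain y z where yz: "y \<in> span K" "\<And>u. u \<in> span K \<Longrightarrow> orthogonal z u" "x = y + z"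
      using orthogonal_subspace_decomp_exists[of K x] by metis
    have yK: "y \<in> K" using yz K by (simp add: span_eq_iff[THEN iffD2])
    have "z = x - y" using yz by simp
    then have "z \<in> S" using x yK S by (simp add: K_def subspace_diff)
    then have "z \<in> C" using yz(2) by (auto simp: C_def orthogonal_commute span_base)
    moreover have "f z = w" using yK by (simp add: x yz K_def linear_add[OF lin])
    ultimately show "w \<in> f ` C" by blast
  qed (auto simp: C_def)
  moreover have "dim C + dim K = dim S"
    unfolding C_def by (rule dim_subspace_orthogonal_to_vectors[OF K S]) (auto simp: K_def)
  ultimately show ?thesis by (simp add: K_def)
qed

lemma rank_plus_nullity:
  fixes A :: "real ^ 'c::finite ^ 'r::finite"
  shows "rank A + dim {x. A *v x = 0} = CARD('c)"
  using dim_linear_image[of "(*v) A" UNIV] by (simp add: rank_dim_range)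

lemma stack_mult_eq_0_iff:
  fixes A :: "real ^ 'c::finite ^ 'r::finite" and B :: "real ^ 'c ^ 's::finite"
  shows "stack A B *v x = 0 \<longleftrightarrow> A *v x = 0 \<and> B *v x = 0"
proof -
  have "(\<forall>i. (stack A B *v x) $ i = 0) \<longleftrightarrow> (\<forall>i. (A *v x) $ i = 0) \<and> (\<forall>i. (B *v x) $ i = 0)"
    by (simp add: stack_def matrix_vector_mult_def split_sum_all)
  then show ?thesis by (simp add: vec_eq_iff)
qed

text \<open>Three applications of rank-nullity: to both matrices \<open>A\<close> and \<open>stack A B\<close>, and to \<open>B\<close> on the kernel
  of \<open>A\<close>, where its own kernel is that of \<open>stack A B\<close>.\<close>

lemma rank_stack:
  fixes A :: "real ^ 'c::finite ^ 'r::finite" and B :: "real ^ 'c ^ 's::finite"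
  shows "rank (stack A B) = rank A + dim ((*v) B ` {x. A *v x = 0})"
proof -
  have "subspace {x. A *v x = 0}" by (rule linear_subspace_kernel) simp
  from dim_linear_image[OF _ this, of "(*v) B"]
  have "dim ((*v) B ` {x. A *v x = 0}) + dim {x. stack A B *v x = 0} = dim {x. A *v x = 0}"
    by (simp add: stack_mult_eq_0_iff)
  then show ?thesis using rank_plus_nullity[of A] rank_plus_nullity[of "stack A B"] by linarith
qed

text \<open>A nonzero maximal minor exhibits \<open>CARD('c)\<close> independent rows, and a basis of the row space chosen
  among the rows of a matrix of full column rank exhibits a nonzero maximal minor.\<close>

lemma rank_less_columns_iff_row_minors:
  fixes A :: "real ^ 'c::finite ^ 'r::finite"
  shows "rank A < CARD('c) \<longleftrightarrow> (\<forall>s :: 'c \<Rightarrow> 'r. inj s \<longrightarrow> row_minor A s = 0)"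
proof
  assume less: "rank A < CARD('c)"
  show "\<forall>s :: 'c \<Rightarrow> 'r. inj s \<longrightarrow> row_minor A s = 0"
  proof (intro allI impI)
    fix s :: "'c \<Rightarrow> 'r"
    have "rows (\<chi> c. A $ s c) \<subseteq> rows A" by (auto simp: rows_def row_def)
    then have "rank (\<chi> c. A $ s c) \<le> rank A" unfolding row_rank_def by (rule dim_subset)
    then show "row_minor A s = 0" using less by (simp add: row_minor_def det_eq_0_rank)
  qed
next
  assume minors: "\<forall>s :: 'c \<Rightarrow> 'r. inj s \<longrightarrow> row_minor A s = 0"
  show "rank A < CARD('c)"
  proof (rule ccontr)
    assume "\<not> rank A < CARD('c)"
    then have dim: "dim (rows A) = CARD('c)"
      using rank_bound[of A] by (simp add: row_rank_def)
    obtain B where B: "B \<subseteq> rows A" "independent B" "rows A \<subseteq> span B" "card B = CARD('c)"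
      using basis_exists[of "rows A"] dim by metis
    have "finite B" using B(2) by (rule independent_imp_finite)
    then obtain g where g: "bij_betw g (UNIV :: 'c set) B"
      using finite_same_card_bij[of "UNIV :: 'c set" B] B(4) by auto
    have "g c \<in> rows A" for c using g B(1) by (auto simp: bij_betw_def)
    then have "\<forall>c. \<exists>r. A $ r = g c" by (simp add: rows_def row_def) metis
    then obtain s where s: "\<And>c. A $ s c = g c" by metis
    have "inj s"
      by (rule injI) (metis g s bij_betw_def injD)
    then have "row_minor A s = 0" using minors by blast
    moreover have "rows (\<chi> c. A $ s c) = B"
      using g by (auto simp: rows_def row_def s bij_betw_def)
    then have "rank (\<chi> c. A $ s c) = CARD('c)"
      using B by (simp add: row_rank_def dim_eq_card_independent)
    ultimately show False by (simp add: row_minor_def det_eq_0_rank)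
  qed
qed

section \<open>Derivatives and analyticity of Laurent polynomials\<close>

text \<open>The partial derivative, computed termwise. This expression is visibly analytic on the torus, in
  contrast to the definition of \<open>laurent_partial\<close> through \<open>deriv\<close>.\<close>

definition laurent_partial_formula :: "'n::finite laurent \<Rightarrow> 'n \<Rightarrow> complex ^ 'n \<Rightarrow> complex" where
  "laurent_partial_formula f k z = (\<Sum>\<alpha>\<in>Poly_Mapping.keys f. Poly_Mapping.lookup f \<alpha> *
     (of_int (\<alpha> $ k) * (z $ k) powi (\<alpha> $ k - 1) * (\<Prod>i\<in>UNIV - {k}. (z $ i) powi (\<alpha> $ i))))"

lemma laurent_eval_has_derivative_formula:
  fixes z :: "complex ^ 'n::finite"
  assumes "z \<in> torus"
  shows "(laurent_eval f has_derivative (\<lambda>h. \<Sum>k\<in>UNIV. laurent_partial_formula f k z * h $ k)) (at z)"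
proof -
  have nz: "z $ k \<noteq> 0" for k using assms by (simp add: torus_def)
  have coord: "((\<lambda>w :: complex ^ 'n. w $ k) has_derivative (\<lambda>h. h $ k)) (at z)" for k
    by (intro bounded_linear_imp_has_derivative bounded_linear_vec_nth)
  have "((\<lambda>w. \<Sum>\<alpha>\<in>Poly_Mapping.keys f. Poly_Mapping.lookup f \<alpha> * (\<Prod>k\<in>UNIV. (w $ k) powi (\<alpha> $ k)))
      has_derivative (\<lambda>h. \<Sum>\<alpha>\<in>Poly_Mapping.keys f. Poly_Mapping.lookup f \<alpha> *
        (\<Sum>k\<in>UNIV. h $ k * (of_int (\<alpha> $ k) * (z $ k) powi (\<alpha> $ k - 1)) *
          (\<Prod>i\<in>UNIV - {k}. (z $ i) powi (\<alpha> $ i))))) (at z)"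
    by (intro has_derivative_sum has_derivative_mult_right has_derivative_prod
        has_derivative_power_int nz coord)
  moreover have "(\<Sum>\<alpha>\<in>Poly_Mapping.keys f. Poly_Mapping.lookup f \<alpha> *
        (\<Sum>k\<in>UNIV. h $ k * (of_int (\<alpha> $ k) * (z $ k) powi (\<alpha> $ k - 1)) *
          (\<Prod>i\<in>UNIV - {k}. (z $ i) powi (\<alpha> $ i))))
      = (\<Sum>k\<in>UNIV. laurent_partial_formula f k z * h $ k)" for h :: "complex ^ 'n"
    unfolding laurent_partial_formula_def sum_distrib_left sum_distrib_right
    by (subst sum.swap) (simp add: mult_ac)
  ultimately show ?thesis by (simp add: laurent_eval_def[abs_def])
qed

lemma laurent_partial_eq:
  fixes z :: "complex ^ 'n::finite"
  assumes "z \<in> torus"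
  shows "laurent_partial f k z = laurent_partial_formula f k z"
proof -
  have line: "(\<chi> i. if i = k then w else z $ i) = z + axis k (w - z $ k)" for w
    by (auto simp: vec_eq_iff axis_def)
  have "linear (axis k :: complex \<Rightarrow> complex ^ 'n)"
    by (rule linearI) (simp_all add: vec_eq_iff axis_def)
  then have bl: "bounded_linear (axis k :: complex \<Rightarrow> complex ^ 'n)"
    by (simp add: linear_conv_bounded_linear)
  have "((\<lambda>w. w - z $ k) has_derivative (\<lambda>h. h)) (at (z $ k))"
    by (auto intro!: derivative_eq_intros)
  from has_derivative_add[OF has_derivative_const bounded_linear.has_derivative[OF bl this], of z]
  have d1: "((\<lambda>w. z + axis k (w - z $ k)) has_derivative (\<lambda>h. axis k h)) (at (z $ k))" by simp
  have zk: "z + axis k (z $ k - z $ k) = z" by (simp add: vec_eq_iff axis_def)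
  have d2: "(laurent_eval f has_derivative (\<lambda>h. \<Sum>i\<in>UNIV. laurent_partial_formula f i z * h $ i))
      (at (z + axis k (z $ k - z $ k)))"
    unfolding zk by (rule laurent_eval_has_derivative_formula[OF assms])
  have "((\<lambda>w. laurent_eval f (z + axis k (w - z $ k))) has_derivative
      (\<lambda>h. \<Sum>i\<in>UNIV. laurent_partial_formula f i z * axis k h $ i)) (at (z $ k))"
    by (rule has_derivative_compose[OF d1 d2])
  moreover have "(\<Sum>i\<in>UNIV. laurent_partial_formula f i z * axis k h $ i) = laurent_partial_formula f k z * h" for h
    by (simp add: axis_def if_distrib[of "\<lambda>x. _ * x"] cong: if_cong)
  ultimately show ?thesis
    unfolding laurent_partial_def line
    by (intro DERIV_imp_deriv) (simp add: has_field_derivative_def)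
qed

lemma laurent_eval_has_derivative:
  "z \<in> torus \<Longrightarrow> (laurent_eval f has_derivative (\<lambda>h. \<Sum>k\<in>UNIV. laurent_partial f k z * h $ k)) (at z)"
  using laurent_eval_has_derivative_formula by (simp add: laurent_partial_eq)

lemma linear_of_real_coords: "linear (of_real_coords :: real ^ ('n + 'n) \<Rightarrow> complex ^ 'n::finite)"
  by (intro linearI) (auto simp: of_real_coords_def vec_eq_iff complex_eq_iff)

lemma linear_to_real: "linear (to_real :: complex ^ 'n::finite \<Rightarrow> real ^ ('n + 'n))"
  by (intro linearI) (auto simp: to_real_def vec_eq_iff split: sum.split)

lemma bounded_linear_of_real_coords: "bounded_linear (of_real_coords :: real ^ ('n + 'n) \<Rightarrow> complex ^ 'n::finite)"
  using linear_of_real_coords by (simp add: linear_conv_bounded_linear)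

lemma bounded_linear_to_real: "bounded_linear (to_real :: complex ^ 'n::finite \<Rightarrow> real ^ ('n + 'n))"
  using linear_to_real by (simp add: linear_conv_bounded_linear)

lemma analytic_at_powi:
  fixes g :: "real ^ 'k::finite \<Rightarrow> 'a::{real_normed_field, banach}"
  assumes "analytic_at g p" "g p \<noteq> 0"
  shows "analytic_at (\<lambda>x. g x powi m) p"
  by (cases "0 \<le> m")
     (simp_all add: power_int_def assms analytic_at_power[OF assms(1)] analytic_at_power[OF analytic_at_inverse[OF assms]])

lemma analytic_at_coord: "analytic_at (\<lambda>X. of_real_coords X $ k) p"
  by (intro analytic_at_linear bounded_linear_compose[OF bounded_linear_vec_nth bounded_linear_of_real_coords])

lemma analytic_at_laurent_eval:
  assumes "of_real_coords p \<in> torus"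
  shows "analytic_at (\<lambda>X. laurent_eval f (of_real_coords X)) p"
  unfolding laurent_eval_def using assms
  by (intro analytic_at_sum analytic_at_mult analytic_at_const analytic_at_prod analytic_at_powi
      analytic_at_coord) (simp add: torus_def)

lemma open_torus: "open (torus :: (complex ^ 'n::finite) set)"
proof -
  have "(torus :: (complex ^ 'n) set) = (\<Inter>k. {z. z $ k \<noteq> 0})" by (auto simp: torus_def)
  moreover have "open (\<Inter>k. {z. z $ k \<noteq> 0} :: (complex ^ 'n) set)"
    by (intro open_INT ballI open_Collect_neq continuous_intros) simp
  ultimately show ?thesis by simp
qed

lemma continuous_of_real_coords: "continuous_on S of_real_coords"
  by (rule linear_continuous_on[OF bounded_linear_of_real_coords])

lemma open_torus_coords: "open {X. of_real_coords X \<in> torus}"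
  using open_vimage[OF open_torus continuous_of_real_coords] by (simp add: vimage_def)

lemma analytic_at_log_partial:
  assumes "of_real_coords p \<in> torus"
  shows "analytic_at (\<lambda>X. log_partial f k (of_real_coords X)) p"
proof (rule analytic_at_cong[OF _ open_torus_coords])
  show "analytic_at (\<lambda>X. of_real_coords X $ k * laurent_partial_formula f k (of_real_coords X)) p"
    unfolding laurent_partial_formula_def using assms
    by (intro analytic_at_sum analytic_at_mult analytic_at_const analytic_at_prod analytic_at_powi
        analytic_at_coord) (simp_all add: torus_def)
  show "p \<in> {X. of_real_coords X \<in> torus}" using assms by simp
  show "of_real_coords X $ k * laurent_partial_formula f k (of_real_coords X) = log_partial f k (of_real_coords X)"
    if "X \<in> {X. of_real_coords X \<in> torus}" for X
    using that by (simp add: log_partial_def laurent_partial_eq)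
qed

lemma analytic_at_G_map:
  assumes "of_real_coords p \<in> torus"
  shows "analytic_at (\<lambda>X. G_map f l iu iv j (of_real_coords X)) p"
proof (rule analytic_at_vec)
  fix i
  have "analytic_at (\<lambda>X. rho f l (j i) (of_real_coords X)) p"
    unfolding rho_def using assms
    by (intro analytic_at_bounded_linear[OF bounded_linear_Im] analytic_at_mult
        analytic_at_bounded_linear[OF bounded_linear_cnj] analytic_at_log_partial)
  moreover have "analytic_at (\<lambda>X. Re (laurent_eval f (of_real_coords X))) p"
    "analytic_at (\<lambda>X. Im (laurent_eval f (of_real_coords X))) p"
    by (rule analytic_at_bounded_linear[OF bounded_linear_Re analytic_at_laurent_eval[OF assms]],
        rule analytic_at_bounded_linear[OF bounded_linear_Im analytic_at_laurent_eval[OF assms]])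
  ultimately show "analytic_at (\<lambda>X. G_map f l iu iv j (of_real_coords X) $ i) p"
    by (cases "i = iu"; cases "i = iv") (simp_all add: G_map_def)
qed

lemma real_jacobian_works:
  assumes "(g \<circ> of_real_coords) differentiable at (to_real z)"
  shows "((g \<circ> of_real_coords) has_derivative (*v) (real_jacobian g z)) (at (to_real z))"
  using assms jacobian_works unfolding real_jacobian_def by blast

section \<open>The critical locus as a zero set\<close>

lemma tangent_space_linear_image:
  assumes T: "bounded_linear T" and v: "v \<in> tangent_space M p"
  shows "T v \<in> tangent_space (T ` M) (T p)"
proof -
  obtain \<gamma> e where *: "v = vector_derivative \<gamma> (at 0)" "0 < e" "\<gamma> C1_differentiable_on {-e<..<e}"
    "\<gamma> ` {-e<..<e} \<subseteq> M" "\<gamma> 0 = p"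
    using v unfolding tangent_space_def by blast
  obtain D where D: "\<And>x. x \<in> {-e<..<e} \<Longrightarrow> (\<gamma> has_vector_derivative D x) (at x)"
    and Dc: "continuous_on {-e<..<e} D"
    using *(3) unfolding C1_differentiable_on_def by blast
  have TD: "((\<lambda>t. T (\<gamma> t)) has_vector_derivative T (D x)) (at x)" if "x \<in> {-e<..<e}" for x
    by (rule bounded_linear.has_vector_derivative[OF T D[OF that]])
  have "continuous_on {-e<..<e} (\<lambda>x. T (D x))"
    by (rule bounded_linear.continuous_on[OF T Dc])
  then have "(\<lambda>t. T (\<gamma> t)) C1_differentiable_on {-e<..<e}"
    unfolding C1_differentiable_on_def by (intro exI[of _ "\<lambda>x. T (D x)"] conjI ballI TD)
  moreover have "vector_derivative (\<lambda>t. T (\<gamma> t)) (at 0) = T v"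
  proof -
    have 0: "0 \<in> {-e<..<e}" using *(2) by simp
    show ?thesis using vector_derivative_at[OF TD[OF 0]] vector_derivative_at[OF D[OF 0]] *(1) by simp
  qed
  ultimately show ?thesis
    unfolding tangent_space_def mem_Collect_eq using *(2,4,5)
    by (intro exI[of _ "\<lambda>t. T (\<gamma> t)"] conjI exI[of _ e]) auto
qed

lemma to_real_tangent_space:
  "to_real ` tangent_space M z = tangent_space (to_real ` M) (to_real z)"
proof (intro equalityI subsetI)
  fix v assume "v \<in> tangent_space (to_real ` M) (to_real z)"
  from tangent_space_linear_image[OF bounded_linear_of_real_coords this]
  have "of_real_coords v \<in> tangent_space M z" by (simp add: image_image)
  then show "v \<in> to_real ` tangent_space M z" by (metis image_eqI to_real_of_real_coords)
qed (auto intro: tangent_space_linear_image[OF bounded_linear_to_real])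

lemma has_derivative_half_ln_sum_squares:
  fixes a b :: "'a::real_normed_vector \<Rightarrow> real"
  assumes a: "(a has_derivative a') (at z)" and b: "(b has_derivative b') (at z)"
    and pos: "(a z)\<^sup>2 + (b z)\<^sup>2 > 0"
  shows "((\<lambda>w. ln ((a w)\<^sup>2 + (b w)\<^sup>2) / 2) has_derivative
      (\<lambda>h. (a z * a' h + b z * b' h) / ((a z)\<^sup>2 + (b z)\<^sup>2))) (at z)"
  using pos by (auto intro!: derivative_eq_intros a b simp: fun_eq_iff) (simp add: field_simps)

lemma Log_has_derivative:
  fixes z :: "complex ^ 'n::finite"
  assumes "z \<in> torus"
  shows "(Log has_derivative (\<lambda>h. \<chi> k. Re (h $ k / z $ k))) (at z)"
proof -
  have nz: "z $ k \<noteq> 0" for k using assms by (simp add: torus_def)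
  have "((\<lambda>w. ln (cmod (w $ k))) has_derivative (\<lambda>h. Re (h $ k / z $ k))) (at z)" for k
  proof -
    have pos: "(Re (z $ k))\<^sup>2 + (Im (z $ k))\<^sup>2 > 0"
      using nz[of k] by (auto simp: complex_eq_iff sum_power2_gt_zero_iff)
    have R: "((\<lambda>w :: complex ^ 'n. Re (w $ k)) has_derivative (\<lambda>h. Re (h $ k))) (at z)"
      and I: "((\<lambda>w :: complex ^ 'n. Im (w $ k)) has_derivative (\<lambda>h. Im (h $ k))) (at z)"
      by (intro bounded_linear_imp_has_derivative bounded_linear_compose[OF _ bounded_linear_vec_nth]
          bounded_linear_Re bounded_linear_Im)+
    have eq: "(\<lambda>w :: complex ^ 'n. ln (cmod (w $ k))) = (\<lambda>w. ln ((Re (w $ k))\<^sup>2 + (Im (w $ k))\<^sup>2) / 2)"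
      by (simp add: cmod_def ln_sqrt fun_eq_iff)
    show ?thesis
      unfolding eq using has_derivative_half_ln_sum_squares[OF R I pos] by (simp add: Re_divide mult.commute)
  qed
  then show ?thesis
    unfolding Log_def has_derivative_componentwise_within[where f = "\<lambda>Y. \<chi> k. _ Y k"]
    by (auto simp: Basis_vec_def inner_axis)
qed

text \<open>The regular value theorem for the real and imaginary parts of \<open>f\<close>, which are packed into \<open>real ^ bool\<close>.
  The differential is onto because it is complex linear and does not vanish on the \<open>l\<close>-th axis.\<close>

lemma hypersurface_tangent_space:
  fixes z :: "complex ^ 'n::finite"
  assumes z: "z \<in> hypersurface f" and l: "laurent_partial f l z \<noteq> 0"
  shows "tangent_space (hypersurface f) z = {h. (\<Sum>k\<in>UNIV. laurent_partial f k z * h $ k) = 0}"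
proof -
  define d where "d h = (\<Sum>k\<in>UNIV. laurent_partial f k z * h $ k)" for h
  define split :: "complex \<Rightarrow> real ^ bool" where "split w = (\<chi> b. if b then Re w else Im w)" for w
  define G where "G X = split (laurent_eval f (of_real_coords X))" for X
  define D where "D H = split (d (of_real_coords H))" for H
  have tz: "z \<in> torus" and fz: "laurent_eval f z = 0" using z by (auto simp: hypersurface_def)
  have split0: "split w = 0 \<longleftrightarrow> w = 0" for w
    by (auto simp: split_def vec_eq_iff complex_eq_iff)
  have "linear split" by (rule linearI) (auto simp: split_def vec_eq_iff)
  then have bs: "bounded_linear split" by (simp add: linear_conv_bounded_linear)
  have anG: "analytic_at G (to_real z)"
    unfolding G_def by (intro analytic_at_bounded_linear[OF bs] analytic_at_laurent_eval) (simp add: tz)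
  have d1: "(of_real_coords has_derivative of_real_coords) (at (to_real z))"
    by (rule bounded_linear_imp_has_derivative[OF bounded_linear_of_real_coords])
  have "(laurent_eval f has_derivative d) (at (of_real_coords (to_real z)))"
    using laurent_eval_has_derivative[OF tz] unfolding d_def by simp
  from bounded_linear.has_derivative[OF bs has_derivative_compose[OF d1 this]]
  have DG: "(G has_derivative D) (at (to_real z))"
    unfolding G_def D_def .
  have "surj D"
  proof (rule surjI)
    fix y :: "real ^ bool"
    show "D (to_real (axis l (Complex (y $ True) (y $ False) / laurent_partial f l z))) = y"
      using l by (auto simp: D_def d_def split_def vec_eq_iff axis_def if_distrib[of "\<lambda>x. _ * x"] cong: if_cong)
  qed
  note level = analytic_level_set[OF anG DG this open_torus_coords]
  have "tangent_space (to_real ` hypersurface f) (to_real z) = {H. D H = 0}"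
  proof (rule level(2))
    show "to_real ` hypersurface f \<inter> {X. of_real_coords X \<in> torus} =
        {X \<in> {X. of_real_coords X \<in> torus}. G X = 0}"
    proof (intro equalityI subsetI)
      fix X assume "X \<in> {X \<in> {X. of_real_coords X \<in> torus}. G X = 0}"
      then have "of_real_coords X \<in> hypersurface f" by (simp add: hypersurface_def G_def split0)
      moreover have "X = to_real (of_real_coords X)" by simp
      ultimately show "X \<in> to_real ` hypersurface f \<inter> {X. of_real_coords X \<in> torus}"
        by (auto simp: hypersurface_def simp del: to_real_of_real_coords)
    qed (auto simp: hypersurface_def G_def split0)
  qed (use tz fz in \<open>auto simp: G_def split0\<close>)
  then have "of_real_coords ` to_real ` tangent_space (hypersurface f) z = of_real_coords ` {H. D H = 0}"
    by (simp add: to_real_tangent_space)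
  then have "tangent_space (hypersurface f) z = of_real_coords ` {H. d (of_real_coords H) = 0}"
    by (simp add: image_image D_def split0)
  also have "\<dots> = {h. d h = 0}"
    by (auto intro!: image_eqI[where x = "to_real _"])
  finally show ?thesis by (simp add: d_def)
qed

text \<open>The image of \<open>d Log\<close> consists of the real parts of the solutions \<open>w\<close> of \<open>\<Sum>\<^sub>k F\<^sub>k w\<^sub>k = 0\<close>. If all
  \<open>F\<^sub>k cnj F\<^sub>l\<close> are real, the real parts satisfy a real equation in which the \<open>l\<close>-th coefficient is
  \<open>\<bar>F\<^sub>l\<bar>\<^sup>2 > 0\<close>, hence the \<open>l\<close>-th axis vector is missed. Otherwise two imaginary parts can be chosen
  freely enough to reach every real vector.\<close>

lemma critical_locus_iff:
  fixes z :: "complex ^ 'n::finite"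
  assumes z: "z \<in> U_chart f l"
  shows "z \<in> critical_locus f \<longleftrightarrow> laurent_eval f z = 0 \<and> (\<forall>k. k \<noteq> l \<longrightarrow> rho f l k z = 0)"
proof (cases "laurent_eval f z = 0")
  case True
  define F where "F k = log_partial f k z" for k
  have tz: "z \<in> torus" and Fl: "F l \<noteq> 0" using z by (auto simp: U_chart_def F_def)
  have nz: "z $ k \<noteq> 0" for k using tz by (simp add: torus_def)
  have zV: "z \<in> hypersurface f" using tz True by (simp add: hypersurface_def)
  have pl: "laurent_partial f l z \<noteq> 0" using Fl by (auto simp: F_def log_partial_def)
  have partial: "laurent_partial f k z = F k / z $ k" for k
    using nz[of k] by (simp add: F_def log_partial_def)
  have frech: "frechet_derivative Log (at z) = (\<lambda>h. \<chi> k. Re (h $ k / z $ k))"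
    using frechet_derivative_at[OF Log_has_derivative[OF tz]] by simp
  have image: "restr_diff_image Log (hypersurface f) z =
      {t. \<exists>w. (\<forall>k. t $ k = Re (w k)) \<and> (\<Sum>k\<in>UNIV. F k * w k) = 0}"
  proof (intro equalityI subsetI)
    fix t assume "t \<in> {t. \<exists>w. (\<forall>k. t $ k = Re (w k)) \<and> (\<Sum>k\<in>UNIV. F k * w k) = 0}"
    then obtain w where w: "\<And>k. t $ k = Re (w k)" "(\<Sum>k\<in>UNIV. F k * w k) = 0" by blast
    define h where "h = (\<chi> k. z $ k * w k)"
    have "h \<in> tangent_space (hypersurface f) z"
      unfolding hypersurface_tangent_space[OF zV pl] partial using w(2) nz by (simp add: h_def)
    moreover have "t = (\<chi> k. Re (h $ k / z $ k))" using w(1) nz by (simp add: h_def vec_eq_iff)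
    ultimately show "t \<in> restr_diff_image Log (hypersurface f) z"
      unfolding restr_diff_image_def frech by blast
  next
    fix t assume "t \<in> restr_diff_image Log (hypersurface f) z"
    then obtain h where "(\<Sum>k\<in>UNIV. F k / z $ k * h $ k) = 0" "t = (\<chi> k. Re (h $ k / z $ k))"
      unfolding restr_diff_image_def frech hypersurface_tangent_space[OF zV pl] partial by blast
    then show "t \<in> {t. \<exists>w. (\<forall>k. t $ k = Re (w k)) \<and> (\<Sum>k\<in>UNIV. F k * w k) = 0}"
      by (auto intro!: exI[of _ "\<lambda>k. h $ k / z $ k"])
  qed
  have rho: "rho f l k z = Im (F k * cnj (F l))" for k by (simp add: rho_def F_def)
  have "restr_diff_image Log (hypersurface f) z = UNIV \<longleftrightarrow> (\<exists>m. m \<noteq> l \<and> rho f l m z \<noteq> 0)"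
  proof
    assume all: "restr_diff_image Log (hypersurface f) z = UNIV"
    show "\<exists>m. m \<noteq> l \<and> rho f l m z \<noteq> 0"
    proof (rule ccontr)
      assume "\<not> (\<exists>m. m \<noteq> l \<and> rho f l m z \<noteq> 0)"
      then have im: "Im (F k * cnj (F l)) = 0" for k
        unfolding rho by (cases "k = l") auto
      have "axis l 1 \<in> restr_diff_image Log (hypersurface f) z" by (simp add: all)
      then obtain w where w: "\<And>k. axis l 1 $ k = Re (w k)" "(\<Sum>k\<in>UNIV. F k * w k) = 0"
        unfolding image by blast
      have "0 = Re (cnj (F l) * (\<Sum>k\<in>UNIV. F k * w k))" by (simp only: w(2)) simp
      also have "\<dots> = (\<Sum>k\<in>UNIV. Re ((F k * cnj (F l)) * w k))"
        by (simp only: sum_distrib_left Re_sum) (simp only: mult_ac)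
      also have "\<dots> = (\<Sum>k\<in>UNIV. Re (F k * cnj (F l)) * axis l 1 $ k)"
        by (intro sum.cong refl) (simp only: times_complex.sel(1) im w(1) mult_zero_left diff_zero)
      also have "\<dots> = Re (F l * cnj (F l))"
        by (simp add: axis_def if_distrib[of "\<lambda>x. _ * x"] cong: if_cong)
      finally show False using Fl by (simp add: complex_norm_square[symmetric] complex_eq_iff sum_power2_eq_zero_iff)
    qed
  next
    assume "\<exists>m. m \<noteq> l \<and> rho f l m z \<noteq> 0"
    then obtain m where m: "m \<noteq> l" "Im (F m * cnj (F l)) \<noteq> 0" by (auto simp: rho)
    define dm where "dm = F m * cnj (F l)"
    define e where "e = (cmod (F l))\<^sup>2"
    have e: "e \<noteq> 0" "F l * cnj (F l) = of_real e"
      using Fl by (simp_all add: e_def complex_norm_square[symmetric])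
    have "t \<in> restr_diff_image Log (hypersurface f) z" for t
    proof -
      \<comment> \<open>Imaginary parts \<open>a\<close> at \<open>m\<close> and \<open>b\<close> at \<open>l\<close>: after multiplication by \<open>cnj (F l)\<close>, the equation for
        \<open>w\<close> is \<open>c + \<i> (dm a + e b) = 0\<close>. As \<open>e\<close> is real, its real part determines \<open>a\<close>, and then
        its imaginary part determines \<open>b\<close>.\<close>
      define c where "c = cnj (F l) * (\<Sum>k\<in>UNIV. F k * of_real (t $ k))"
      define a where "a = Re c / Im dm"
      define b where "b = - (Im c + Re dm * a) / e"
      define s where "s k = (if k = m then a else 0) + (if k = l then b else 0)" for k
      define w where "w k = Complex (t $ k) (s k)" for k
      have w: "w k = of_real (t $ k) + \<i> * of_real (s k)" for k
        by (simp add: w_def complex_eq_iff)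
      have "(\<Sum>k\<in>UNIV. F k * of_real (s k)) = F m * of_real a + F l * of_real b"
        by (simp add: s_def distrib_left sum.distrib if_distrib[of of_real] if_distrib[of "\<lambda>x. _ * x"]
            cong: if_cong)
      then have "cnj (F l) * (\<Sum>k\<in>UNIV. F k * w k) = c + \<i> * (cnj (F l) * (F m * of_real a + F l * of_real b))"
        by (simp add: w c_def distrib_left sum.distrib sum_distrib_left[symmetric] mult.left_commute[of _ \<i>])
      also have "\<dots> = c + \<i> * (dm * of_real a + of_real e * of_real b)"
        by (simp add: dm_def e(2)[symmetric] algebra_simps)
      also have "\<dots> = 0"
        using m(2) e(1) by (simp add: complex_eq_iff a_def b_def dm_def[symmetric])
      finally have "(\<Sum>k\<in>UNIV. F k * w k) = 0" using Fl by simp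
      moreover have "t $ k = Re (w k)" for k by (simp add: w_def)
      ultimately show ?thesis unfolding image by blast
    qed
    then show "restr_diff_image Log (hypersurface f) z = UNIV" by blast
  qed
  then show ?thesis using True zV by (auto simp: critical_locus_def)
qed (auto simp: critical_locus_def hypersurface_def)

lemma open_U_chart: "open {X. of_real_coords X \<in> U_chart f l}"
proof -
  have "continuous_on {X. of_real_coords X \<in> torus} (\<lambda>X. log_partial f l (of_real_coords X))"
    by (intro continuous_at_imp_continuous_on ballI differentiable_imp_continuous_within
        analytic_at_imp_differentiable analytic_at_log_partial) simp
  then have "open ({X. of_real_coords X \<in> torus} \<inter> (\<lambda>X. log_partial f l (of_real_coords X)) -` (- {0}))"
    by (rule continuous_open_preimage[OF _ open_torus_coords]) (simp add: open_Compl)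
  moreover have "{X. of_real_coords X \<in> torus} \<inter> (\<lambda>X. log_partial f l (of_real_coords X)) -` (- {0}) =
      {X. of_real_coords X \<in> U_chart f l}"
    by (auto simp: U_chart_def)
  ultimately show ?thesis by simp
qed

lemma G_map_eq_0_iff:
  assumes ord: "row_ordering l iu iv j"
  shows "G_map f l iu iv j z = 0 \<longleftrightarrow> laurent_eval f z = 0 \<and> (\<forall>k. k \<noteq> l \<longrightarrow> rho f l k z = 0)"
proof -
  have "j ` (UNIV - {iu, iv}) = UNIV - {l}" and ne: "iu \<noteq> iv"
    using ord by (auto simp: row_ordering_def bij_betw_def)
  then have "(\<forall>k. k \<noteq> l \<longrightarrow> rho f l k z = 0) \<longleftrightarrow> (\<forall>k \<in> j ` (UNIV - {iu, iv}). rho f l k z = 0)" by auto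
  also have "\<dots> \<longleftrightarrow> (\<forall>i. i \<noteq> iu \<longrightarrow> i \<noteq> iv \<longrightarrow> rho f l (j i) z = 0)" by auto
  finally show ?thesis
    using ne by (auto simp: G_map_def vec_eq_iff complex_eq_iff)
qed

theorem critical_locus_in_chart:
  assumes "row_ordering l iu iv j"
  shows "critical_locus f \<inter> U_chart f l = {z \<in> U_chart f l. G_map f l iu iv j z = 0}"
  using critical_locus_iff[of _ f l] G_map_eq_0_iff[OF assms, of f] by auto

section \<open>The critical locus near a regular point\<close>

lemma DLog_mult:
  assumes "z \<in> torus"
  shows "DLog z *v X = frechet_derivative Log (at z) (of_real_coords X)"
proof -
  have d1: "(of_real_coords has_derivative of_real_coords) (at (to_real z))"
    by (rule bounded_linear_imp_has_derivative[OF bounded_linear_of_real_coords])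
  have L: "(Log has_derivative frechet_derivative Log (at z)) (at z)"
    using Log_has_derivative[OF assms] frechet_derivative_works differentiable_def by blast
  then have "(Log has_derivative frechet_derivative Log (at z)) (at (of_real_coords (to_real z)))" by simp
  from has_derivative_compose[OF d1 this]
  have c: "((Log \<circ> of_real_coords) has_derivative (\<lambda>X. frechet_derivative Log (at z) (of_real_coords X))) (at (to_real z))"
    by (simp add: o_def)
  then have "(Log \<circ> of_real_coords) differentiable at (to_real z)" by (auto simp: differentiable_def)
  from has_derivative_unique[OF real_jacobian_works[OF this] c]
  show ?thesis unfolding DLog_def by metis
qed

theorem proposition2p1:
  fixes f :: "'n::finite laurent" and l :: 'n
    and iu iv :: "'r::finite" and j :: "'r \<Rightarrow> 'n"
    and q :: "complex ^ 'n"
  assumes smooth: "smooth_hypersurface f"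
    and ordering: "row_ordering l iu iv j"
    and q: "q \<in> critical_locus f \<inter> U_chart f l"
    and full_rank: "rank (DG f l iu iv j q) = CARD('n) + 1"
  shows "analytic_submanifold_near (to_real ` critical_locus f) (CARD('n) - 1) (to_real q) \<and>
    to_real ` tangent_space (critical_locus f) q = {X. DG f l iu iv j q *v X = 0} \<and>
    int (restr_diff_rank Log (critical_locus f) q) =
      int (rank (augmented f l iu iv j q)) - (int CARD('n) + 1) \<and>
    (restr_diff_rank Log (critical_locus f) q < CARD('n) - 1 \<longleftrightarrow>
      rank (augmented f l iu iv j q) < 2 * CARD('n)) \<and>
    CARD('r + 'n) = 2 * CARD('n) + 1 \<and> CARD('n + 'n) = 2 * CARD('n) \<and>
    (rank (augmented f l iu iv j q) < 2 * CARD('n) \<longleftrightarrow>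
      (\<forall>s :: 'n + 'n \<Rightarrow> 'r + 'n. inj s \<longrightarrow> row_minor (augmented f l iu iv j q) s = 0))"
proof -
  define J where "J = DG f l iu iv j q"
  define K where "K = {X. J *v X = 0}"
  have qU: "q \<in> U_chart f l" and qt: "q \<in> torus" using q by (auto simp: U_chart_def)
  have cr: "CARD('r) = CARD('n) + 1" by (rule row_ordering_card[OF ordering])
  have an: "analytic_at (G_map f l iu iv j \<circ> of_real_coords) (to_real q)"
    unfolding o_def by (rule analytic_at_G_map) (simp add: qt)
  have DGq: "((G_map f l iu iv j \<circ> of_real_coords) has_derivative (*v) J) (at (to_real q))"
    unfolding J_def DG_def by (rule real_jacobian_works[OF analytic_at_imp_differentiable[OF an]])
  have surj: "surj ((*v) J)"
    using full_rank cr by (simp add: J_def full_rank_surjective[symmetric])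
  have locus: "to_real ` critical_locus f \<inter> {X. of_real_coords X \<in> U_chart f l} =
      {X \<in> {X. of_real_coords X \<in> U_chart f l}. (G_map f l iu iv j \<circ> of_real_coords) X = 0}" (is "?A = ?B")
  proof -
    have "?A = to_real ` (critical_locus f \<inter> U_chart f l)"
      by (auto intro: image_eqI)
    also have "\<dots> = to_real ` {z \<in> U_chart f l. G_map f l iu iv j z = 0}"
      by (simp only: critical_locus_in_chart[OF ordering])
    also have "\<dots> = ?B"
      by (auto intro!: image_eqI[where f = to_real and x = "of_real_coords _"])
    finally show ?thesis .
  qed
  have Gq: "(G_map f l iu iv j \<circ> of_real_coords) (to_real q) = 0"
    using q critical_locus_in_chart[OF ordering, of f] by auto
  have qU': "to_real q \<in> {X. of_real_coords X \<in> U_chart f l}" using qU by simp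
  note level = analytic_level_set[OF an DGq surj open_U_chart qU' locus Gq]
  have nullity: "rank J + dim K = 2 * CARD('n)"
    using rank_plus_nullity[of J] by (simp add: K_def)
  have rJ: "rank J = CARD('n) + 1" using full_rank by (simp add: J_def)
  have "dim K = CARD('n) - 1" using nullity rJ by linarith
  then have submanifold: "analytic_submanifold_near (to_real ` critical_locus f) (CARD('n) - 1) (to_real q)"
    using level(1) by (simp add: K_def)
  have tangent: "to_real ` tangent_space (critical_locus f) q = K"
    using level(2) by (simp add: to_real_tangent_space K_def)
  then have "tangent_space (critical_locus f) q = of_real_coords ` K"
    by (metis (no_types, lifting) image_ident image_image of_real_coords_to_real image_cong)
  then have "restr_diff_image Log (critical_locus f) q = (*v) (DLog q) ` K"
    unfolding restr_diff_image_def by (simp add: image_image DLog_mult[OF qt])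
  then have rank: "rank (augmented f l iu iv j q) = CARD('n) + 1 + restr_diff_rank Log (critical_locus f) q"
    using rank_stack[of J "DLog q"] rJ
    by (simp add: restr_diff_rank_def augmented_def J_def[symmetric] K_def)
  have "(0::nat) < CARD('n)" by simp
  then have drop: "restr_diff_rank Log (critical_locus f) q < CARD('n) - 1 \<longleftrightarrow>
      rank (augmented f l iu iv j q) < 2 * CARD('n)"
    using rank by linarith
  have "rank (augmented f l iu iv j q) < 2 * CARD('n) \<longleftrightarrow>
      (\<forall>s :: 'n + 'n \<Rightarrow> 'r + 'n. inj s \<longrightarrow> row_minor (augmented f l iu iv j q) s = 0)"
    using rank_less_columns_iff_row_minors[of "augmented f l iu iv j q"] by (simp add: mult_2)
  then show ?thesis
    using submanifold tangent rank drop cr by (auto simp: J_def K_def)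
qed

end
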